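(* Let $h$ be a function with polynomial growth belonging to a Hardy field, and suppose \[ \lim_{x\to\infty}\frac{|h'(x)-p(x)|}{\log x}=\infty\quad\text{for all }p\in\mathbb{Q}[x]. \] Then there exists a function $V\in\mathscr{W}^*$ belonging to a Hardy field with $\lim_{N\to\infty}\frac{\sqrt N}{\log V(N)}=0$ such that \[ \lim_{N\to\infty}\mathbb{E}_{n\in[N-s(N),N]}e^{2\pi i k h(n)}=0 \] for all $k\in\mathbb{Z}\setminus\{0\}$ and all $s\colon\mathbb{N}\to\mathbb{N}$ with $\lim_{N\to\infty}s(N)\cdot\Delta\log(V(N))=\infty$.
   Context: Polynomial growth: there exist $c,d\ge1$ with $|h(x)|\le x^d$ for $x\ge c$. A Hardy field is a field of germs at $\infty$ of real-valued differentiable functions closed under differentiation. For $U\colon\mathbb{N}\to\mathbb{R}$, $\Delta U(N)=U(N)-U(N-1)$ for $N\ge2$, $\Delta U(1)=U(1)$, $\Delta^2U=\Delta(\Delta U)$. $\mathscr{W}^*$ is the class of eventually non-decreasing $W\colon\mathbb{N}\to[0,\infty)$ with $W(N)\to\infty$ such that $\lim_{N\to\infty}\frac{N\Delta^2W(N)}{\Delta W(N)}$ exists in $\mathbb{R}\cup\{\pm\infty\}$. $\mathbb{E}_{n\in[a,b]}f(n)=\frac{1}{b-a}\sum_{n=a}^bf(n)$. *)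

theory Defs
  imports "HOL-Analysis.Analysis" "HOL-Computational_Algebra.Polynomial"
begin

text \<open>
  A set of germs at infinity is represented by the set of all total functions
  having one of these germs, i.e. by a set that is saturated under eventual equality
  (first clause). Field operations and derivative are then those of the germs;
  in particular "nonzero" means "not eventually zero". The values of a representative
  outside a neighbourhood of infinity are irrelevant.
\<close>

definition hardy_field :: "(real \<Rightarrow> real) set \<Rightarrow> bool" where
  "hardy_field H \<longleftrightarrow>
     (\<forall>f\<in>H. \<forall>g. (\<forall>\<^sub>F x in at_top. g x = f x) \<longrightarrow> g \<in> H) \<and>
     (\<forall>f\<in>H. \<forall>\<^sub>F x in at_top. f differentiable (at x)) \<and>
     (\<lambda>_. 0) \<in> H \<and> (\<lambda>_. 1) \<in> H \<and>
     (\<forall>f\<in>H. \<forall>g\<in>H. (\<lambda>x. f x + g x) \<in> H) \<and>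
     (\<forall>f\<in>H. (\<lambda>x. - f x) \<in> H) \<and>
     (\<forall>f\<in>H. \<forall>g\<in>H. (\<lambda>x. f x * g x) \<in> H) \<and>
     (\<forall>f\<in>H. \<not> (\<forall>\<^sub>F x in at_top. f x = 0) \<longrightarrow>
        (\<exists>g\<in>H. \<forall>\<^sub>F x in at_top. f x * g x = 1)) \<and>
     (\<forall>f\<in>H. deriv f \<in> H)"

definition in_hardy_field :: "(real \<Rightarrow> real) \<Rightarrow> bool" where
  "in_hardy_field f \<longleftrightarrow> (\<exists>H. hardy_field H \<and> f \<in> H)"

definition polynomial_growth :: "(real \<Rightarrow> real) \<Rightarrow> bool" where
  "polynomial_growth h \<longleftrightarrow> (\<exists>c\<ge>1. \<exists>d\<ge>1. \<forall>x\<ge>c. \<bar>h x\<bar> \<le> x powr d)"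

text \<open>
  Sequences are indexed by the positive integers; their value at \<open>0\<close> is a dummy
  that no notion below depends on.
\<close>

definition bdiff :: "(nat \<Rightarrow> real) \<Rightarrow> nat \<Rightarrow> real" where
  "bdiff U N = (if N \<ge> 2 then U N - U (N - 1) else U N)"

text \<open>
  The requirement that \<open>bdiff W\<close> is eventually nonzero makes the quotient
  in the last clause meaningful; it guards against division by zero yielding zero.
\<close>

definition W_star :: "(nat \<Rightarrow> real) set" where
  "W_star = {W.
     (\<forall>N\<ge>1. 0 \<le> W N) \<and>
     (\<exists>N0\<ge>1. \<forall>M N. N0 \<le> M \<and> M \<le> N \<longrightarrow> W M \<le> W N) \<and>
     filterlim W at_top sequentially \<and>
     (\<forall>\<^sub>F N in sequentially. bdiff W N \<noteq> 0) \<and>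
     (\<exists>L::ereal. (\<lambda>N. ereal (real N * bdiff (bdiff W) N / bdiff W N)) \<longlonglongrightarrow> L)}"

text \<open>
  The average of a function on the positive integers over an interval of integers,
  normalised by \<open>b - a\<close> although there are \<open>b - a + 1\<close> terms. If the interval
  sticks out of the positive integers, the missing terms count as zero.
\<close>

definition avg :: "int \<Rightarrow> int \<Rightarrow> (nat \<Rightarrow> complex) \<Rightarrow> complex" where
  "avg a b f = (\<Sum>n\<in>{n::nat. 1 \<le> n \<and> a \<le> int n \<and> int n \<le> b}. f n) / of_int (b - a)"

end

(*
Write e(x) = exp(2 pi i x). Adjoin the identity to the Hardy field and subtract from h a rational
polynomial, which is periodic modulo 1 on the integers, so that for the rest f one of the following
holds: (B) some derivative f^(d), d >= 1, tends to an irrational number; (A) f^(d) tends to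
infinity in absolute value and f^(d+1) tends to 0, for some d >= 1.

Both cases reduce to Weyl's theorem for one irrational leading coefficient, uniformly in the
lower coefficients. In case (B) the values of k f along a progression of fixed step and bounded
length are, up to o(1), those of a polynomial of degree d with irrational leading coefficient, so
intervals of any length tending to infinity are good, and V = exp works. In case (A) put D = d + 1 and
l = |f^(D)|. Near N the values of k f along a progression of step q are nearly those of a polynomial of
degree D with leading coefficient k q^D l(N) / D!; choosing q close to a multiple of l(N)^(-1/D)
makes this leading coefficient nearly a fixed irrational number. Hence intervals much longer than
l(N)^(-1/D) are
good, and V = exp v with v' = l^(1/D) works. The logarithm in the hypothesis matters only for D = 2, where it gives
x l(x) -> infinity, which is what makes v grow faster than sqrt x.

That V lies in a Hardy field follows from the adjunction of solutions of y' = a y + b.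
*)

theory Submission
  imports Defs
begin

section \<open>Weyl sums with an irrational leading coefficient\<close>

text \<open>Cutting an interval into blocks and each block into progressions gives no control over
  the lower coefficients of the approximating polynomials, which change from one progression to the
  next. Hence the bound for Weyl sums has to depend on the leading coefficient alone.

  One V has to serve every k. The step is therefore adapted to l only: with r = (theta / l)^(1/D)
  for a single irrational theta and a step near Q r, where Q is a period modulo 1 of the subtracted
  polynomial, the leading coefficient for k is about k Q^D theta / D! up to sign, which is
  irrational for all nonzero k at once. Rounding r is harmless because r tends to infinity. The
  variation of l over a block is harmless because the step is small compared with its position and l
  decays no faster than a fixed power.

  The weight is dictated by the condition on s: the increment of log V at N is at most a constant
  times l(N)^(1/D), which is comparable to the reciprocal of the step. So the condition makes the
  interval long compared with the step.\<close>

definition e :: "real \<Rightarrow> complex" where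
  "e x = cis (2 * pi * x)"

text \<open>The type is left open because the same operator acts on sequences with step 1 and on
  real functions with step q. A sequence with constant differences of order D is a polynomial of
  degree at most D, described without its lower coefficients.\<close>

definition fdiff :: "'a::plus \<Rightarrow> ('a \<Rightarrow> real) \<Rightarrow> 'a \<Rightarrow> real" where
  "fdiff q f x = f (x + q) - f x"

lemma norm_e [simp]: "norm (e x) = 1"
  by (simp add: e_def)

lemma e_add: "e (x + y) = e x * e y"
  by (simp add: e_def cis_mult ring_distribs)

lemma cnj_e: "cnj (e x) = e (- x)"
  by (simp add: e_def cis_cnj)

lemma e_diff: "e (x - y) = e x * cnj (e y)"
  using e_add[of x "- y"] by (simp add: cnj_e)

lemma e_mult_of_nat: "e (of_nat n * x) = e x ^ n"
proof -
  have "e x ^ n = cis (real n * (2 * pi * x))" unfolding e_def by (rule Complex.DeMoivre)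
  also have "real n * (2 * pi * x) = 2 * pi * (real n * x)" by simp
  finally show ?thesis by (simp only: e_def)
qed

lemma e_Ints: "x \<in> \<int> \<Longrightarrow> e x = 1"
  by (auto simp: e_def cis_multiple_2pi elim!: Ints_cases)

lemma e_eq_1_D: "e x = 1 \<Longrightarrow> x \<in> \<int>"
proof -
  assume "e x = 1"
  then have "cos (2 * pi * x) = 1"
    by (simp add: e_def complex_eq_iff)
  then obtain n :: int where "2 * pi * x = of_int n * 2 * pi"
    by (auto simp: cos_one_2pi_int)
  then have "x = of_int n" by simp
  then show ?thesis by simp
qed

lemma norm_e_diff_le: "norm (e x - e y) \<le> 2 * pi * \<bar>x - y\<bar>"
proof -
  have "e x - e y = e y * (exp (\<i> * of_real (2 * pi * (x - y))) - 1)"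
    using e_add[of y "x - y"] by (simp add: e_def cis_conv_exp algebra_simps)
  then have "norm (e x - e y) = 2 * \<bar>sin (2 * pi * (x - y) / 2)\<bar>"
    by (simp add: norm_mult dist_exp_i_1 del: of_real_mult)
  also have "\<dots> \<le> 2 * \<bar>2 * pi * (x - y) / 2\<bar>"
    using abs_sin_x_le_abs_x by (intro mult_left_mono) auto
  finally show ?thesis by (simp add: abs_mult)
qed

text \<open>Each shift of the window by one drops one term and gains one.\<close>

lemma norm_shifted_sum_diff_le:
  fixes z :: "nat \<Rightarrow> complex"
  assumes "\<And>m. norm (z m) \<le> 1"
  shows "norm ((\<Sum>m<L. z (m + i)) - (\<Sum>m<L. z m)) \<le> 2 * real i"
proof (induction i)
  case (Suc i)
  have "(\<Sum>m<L. z (m + Suc i)) - (\<Sum>m<L. z (m + i)) = z (L + i) - z i"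
    using sum_lessThan_telescope[of "\<lambda>m. z (m + i)" L] by (simp add: sum_subtractf)
  moreover have "norm (z (L + i) - z i) \<le> 2"
    by (rule order_trans[OF norm_triangle_ineq4]) (use assms[of "L + i"] assms[of i] in linarith)
  ultimately have "norm ((\<Sum>m<L. z (m + Suc i)) - (\<Sum>m<L. z (m + i))) \<le> 2"
    by simp
  then show ?case
    using Suc norm_diff_triangle_le[of "\<Sum>m<L. z (m + Suc i)" "\<Sum>m<L. z (m + i)" 2
        "\<Sum>m<L. z m" "2 * real i"] by simp
qed simp

text \<open>H times the sum is compared with the total T of H shifted window sums, and
  Cauchy-Schwarz is applied to T. The sequence continues beyond the window, so all correlations run
  over the same m < L and the boundary costs only the additive term 2 H.\<close>

lemma van_der_Corput_ineq:
  fixes z :: "nat \<Rightarrow> complex" and H L :: nat and \<delta> :: real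
  assumes z: "\<And>m. norm (z m) \<le> 1" and H: "H \<ge> 1" and \<delta>: "\<delta> \<ge> 0"
    and corr: "\<And>i j. j < i \<Longrightarrow> i < H \<Longrightarrow> norm (\<Sum>m<L. z (m + i) * cnj (z (m + j))) \<le> \<delta> * L"
  shows "norm (\<Sum>m<L. z m) \<le> L * sqrt (1 / H + \<delta>) + 2 * real H"
proof -
  define S where "S = (\<Sum>m<L. z m)"
  define T where "T = (\<Sum>m<L. \<Sum>i<H. z (m + i))"
  have T_swap: "T = (\<Sum>i<H. \<Sum>m<L. z (m + i))"
    unfolding T_def by (rule sum.swap)
  have "norm (T - of_nat H * S) = norm (\<Sum>i<H. (\<Sum>m<L. z (m + i)) - S)"
    by (simp add: T_swap sum_subtractf)
  also have "\<dots> \<le> (\<Sum>i<H. 2 * real H)"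
  proof (rule sum_norm_le)
    fix i assume "i \<in> {..<H}"
    then show "norm ((\<Sum>m<L. z (m + i)) - S) \<le> 2 * real H"
      using norm_shifted_sum_diff_le[of z i L] z unfolding S_def by auto
  qed
  finally have TS: "norm (T - of_nat H * S) \<le> 2 * real H * real H" by simp
  \<comment> \<open>The diagonal contributes L for each index; the pairs with i < j follow from
    \<open>corr\<close> by conjugation.\<close>
  have corr2: "norm (\<Sum>m<L. z (m + i) * cnj (z (m + j))) \<le> (if i = j then real L else 0) + \<delta> * L"
    if "i < H" "j < H" for i j
  proof (cases i j rule: linorder_cases)
    case less
    have "norm (\<Sum>m<L. z (m + i) * cnj (z (m + j))) = norm (cnj (\<Sum>m<L. z (m + i) * cnj (z (m + j))))"
      by (simp only: complex_mod_cnj)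
    also have "\<dots> = norm (\<Sum>m<L. z (m + j) * cnj (z (m + i)))"
      by (simp add: mult.commute)
    finally show ?thesis using corr[OF less] that less by simp
  next
    case equal
    have "norm (\<Sum>m<L. z (m + i) * cnj (z (m + j))) \<le> (\<Sum>m<L. 1)"
      using z equal by (intro sum_norm_le) (simp add: norm_mult mult_le_one)
    then show ?thesis using equal \<delta> by (simp add: add_increasing2)
  next
    case greater
    then show ?thesis using corr[OF greater] that by simp
  qed
  \<comment> \<open>The squared norm is z times its conjugate, so expanding it over the complex
    numbers brings out the correlations.\<close>
  have "complex_of_real (\<Sum>m<L. (norm (\<Sum>i<H. z (m + i)))\<^sup>2)
      = (\<Sum>m<L. (\<Sum>i<H. z (m + i)) * cnj (\<Sum>j<H. z (m + j)))"
    by (simp only: of_real_sum complex_norm_square)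
  also have "\<dots> = (\<Sum>m<L. \<Sum>i<H. \<Sum>j<H. z (m + i) * cnj (z (m + j)))"
    by (simp add: sum_product)
  also have "\<dots> = (\<Sum>i<H. \<Sum>m<L. \<Sum>j<H. z (m + i) * cnj (z (m + j)))"
    by (rule sum.swap)
  also have "\<dots> = (\<Sum>i<H. \<Sum>j<H. \<Sum>m<L. z (m + i) * cnj (z (m + j)))"
    by (intro sum.cong refl sum.swap)
  finally have "norm (complex_of_real (\<Sum>m<L. (norm (\<Sum>i<H. z (m + i)))\<^sup>2))
      \<le> (\<Sum>i<H. \<Sum>j<H. (if i = j then real L else 0) + \<delta> * L)"
    using corr2 by (auto intro!: sum_norm_le)
  also have "\<dots> = real H * L + real H * real H * \<delta> * L"
    by (simp add: sum.distrib algebra_simps)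
  finally have sq: "(\<Sum>m<L. (norm (\<Sum>i<H. z (m + i)))\<^sup>2) \<le> real H * L + real H * real H * \<delta> * L"
    unfolding norm_of_real by linarith
  have root: "(sqrt (1 / H + \<delta>))\<^sup>2 = 1 / H + \<delta>"
    using \<delta> by simp
  have "(norm T)\<^sup>2 \<le> (\<Sum>m<L. norm (\<Sum>i<H. z (m + i)))\<^sup>2"
    unfolding T_def by (intro power_mono norm_sum norm_ge_zero)
  also have "\<dots> \<le> (\<Sum>m<L. (norm (\<Sum>i<H. z (m + i)))\<^sup>2) * real (card {..<L})"
    by (rule sum_squared_le_sum_of_squares) 
  also have "\<dots> \<le> (real H * L + real H * real H * \<delta> * L) * L"
    using sq by (simp add: mult_right_mono)
  also have "\<dots> = (real H)\<^sup>2 * (real L)\<^sup>2 * (1 / H + \<delta>)"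
    using H by (simp add: power2_eq_square field_simps)
  also have "\<dots> = (real H * (L * sqrt (1 / H + \<delta>)))\<^sup>2"
    by (simp only: power_mult_distrib root mult.assoc)
  finally have "(norm T)\<^sup>2 \<le> (real H * (L * sqrt (1 / H + \<delta>)))\<^sup>2" .
  then have T: "norm T \<le> real H * (L * sqrt (1 / H + \<delta>))"
    by (rule power2_le_imp_le) (use \<delta> in simp)
  have "real H * norm S = norm (of_nat H * S)"
    by (simp add: norm_mult)
  also have "\<dots> \<le> norm T + norm (T - of_nat H * S)"
    using norm_triangle_sub[of "of_nat H * S" T] by (simp add: norm_minus_commute)
  also have "\<dots> \<le> real H * (L * sqrt (1 / H + \<delta>)) + 2 * real H * real H"
    using T TS by (rule add_mono)
  also have "\<dots> = real H * (L * sqrt (1 / H + \<delta>) + 2 * real H)"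
    by (simp only: distrib_left mult.assoc mult.left_commute)
  finally show ?thesis
    using H unfolding S_def by (subst (asm) mult_le_cancel_left_pos) auto
qed

section \<open>Finite differences and Weyl differencing\<close>

lemma fdiff_add_fun: "fdiff q (\<lambda>x. f x + g x) = (\<lambda>x. fdiff q f x + fdiff q g x)"
  by (simp add: fdiff_def fun_eq_iff)

lemma funpow_fdiff_add: "(fdiff q ^^ D) (\<lambda>x. f x + g x) = (\<lambda>x. (fdiff q ^^ D) f x + (fdiff q ^^ D) g x)"
  by (induction D) (simp_all add: fdiff_add_fun)

lemma funpow_fdiff_cmult: "(fdiff q ^^ D) (\<lambda>x. c * f x) = (\<lambda>x. c * (fdiff q ^^ D) f x)"
  by (induction D) (simp_all add: fdiff_def fun_eq_iff right_diff_distrib)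

lemma funpow_fdiff_shift:
  fixes f :: "'a::ab_semigroup_add \<Rightarrow> real"
  shows "(fdiff q ^^ D) (\<lambda>x. f (x + c)) x = (fdiff q ^^ D) f (x + c)"
  by (induction D arbitrary: x) (simp_all add: fdiff_def ac_simps)

text \<open>Subtracting two translates lowers the degree by one and multiplies the leading constant
  by i - j, so for j < i an irrational constant stays irrational.\<close>

lemma funpow_fdiff_shift_diff:
  fixes f :: "nat \<Rightarrow> real"
  assumes "\<And>m. (fdiff 1 ^^ Suc D) f m = \<beta>" and "j \<le> i"
  shows "(fdiff 1 ^^ D) (\<lambda>m. f (m + i) - f (m + j)) m = real (i - j) * \<beta>"
proof -
  have 1: "(fdiff 1 ^^ D) f (m + Suc 0) = (fdiff 1 ^^ D) f m + \<beta>" for m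
    using assms(1)[of m] by (simp add: fdiff_def)
  have 2: "(fdiff 1 ^^ D) f (m + n) = (fdiff 1 ^^ D) f m + real n * \<beta>" for m n
  proof (induction n)
    case (Suc n)
    then show ?case using 1[of "m + n"] by (simp add: algebra_simps)
  qed simp
  have "(\<lambda>m. f (m + i) - f (m + j)) = (\<lambda>m. f (m + i) + (- 1) * f (m + j))"
    by simp
  then have "(fdiff 1 ^^ D) (\<lambda>m. f (m + i) - f (m + j)) m
      = (fdiff 1 ^^ D) (\<lambda>m. f (m + i)) m + (- 1) * (fdiff 1 ^^ D) (\<lambda>m. f (m + j)) m"
    by (simp only: funpow_fdiff_add funpow_fdiff_cmult)
  also have "\<dots> = (fdiff 1 ^^ D) f (m + i) - (fdiff 1 ^^ D) f (m + j)"
    using funpow_fdiff_shift[of D 1 f i m] funpow_fdiff_shift[of D 1 f j m] by simp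
  also have "\<dots> = real (i - j) * \<beta>"
    unfolding 2[of m i] 2[of m j] using assms(2) by (simp add: of_nat_diff algebra_simps)
  finally show ?thesis .
qed

text \<open>Induction on the degree by the van der Corput inequality. L0 is chosen before f: the
  base case is a geometric sum whose bound depends on \<beta> only, and the differencing step passes
  on nothing but multiples of \<beta>.\<close>

theorem Weyl_uniform:
  assumes "\<beta> \<notin> \<rat>" and "\<epsilon> > 0"
  shows "\<exists>L0. \<forall>L\<ge>L0. \<forall>f :: nat \<Rightarrow> real. (\<forall>m. (fdiff 1 ^^ Suc D) f m = \<beta>) \<longrightarrow>
           norm (\<Sum>m<L. e (f m)) \<le> \<epsilon> * L"
  using assms
proof (induction D arbitrary: \<beta> \<epsilon>)
  case 0
  have ne: "e \<beta> \<noteq> 1"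
    using e_eq_1_D[of \<beta>] 0 Ints_subset_Rats by auto
  define c where "c = norm (e \<beta> - 1)"
  have c: "c > 0" using ne by (simp add: c_def)
  show ?case
  proof (intro exI[of _ "nat \<lceil>2 / (c * \<epsilon>)\<rceil>"] allI impI)
    fix L and f :: "nat \<Rightarrow> real"
    assume L: "nat \<lceil>2 / (c * \<epsilon>)\<rceil> \<le> L" and f: "\<forall>m. (fdiff 1 ^^ Suc 0) f m = \<beta>"
    have f_eq: "f m = f 0 + real m * \<beta>" for m
    proof (induction m)
      case (Suc m)
      then show ?case using f[rule_format, of m] by (simp add: fdiff_def algebra_simps)
    qed simp
    have "(\<Sum>m<L. e (f m)) = e (f 0) * (\<Sum>m<L. e \<beta> ^ m)"
      by (subst f_eq) (simp add: e_add e_mult_of_nat sum_distrib_left)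
    also have "\<dots> = e (f 0) * ((e \<beta> ^ L - 1) / (e \<beta> - 1))"
      using ne by (simp add: geometric_sum)
    finally have "norm (\<Sum>m<L. e (f m)) = norm (e \<beta> ^ L - 1) / c"
      by (simp add: norm_mult norm_divide c_def)
    also have "\<dots> \<le> 2 / c"
      using c norm_triangle_ineq4[of "e \<beta> ^ L" 1] by (intro divide_right_mono) (auto simp: norm_power)
    also have "\<dots> \<le> \<epsilon> * L"
    proof -
      have "2 / (c * \<epsilon>) \<le> L" using L by linarith
      then show ?thesis using c 0 by (simp add: field_simps)
    qed
    finally show "norm (\<Sum>m<L. e (f m)) \<le> \<epsilon> * L" .
  qed
next
  case (Suc D)
  \<comment> \<open>With 1 / H at most \<delta>, the root in the van der Corput bound is at most
    sqrt (2 \<delta>) = \<epsilon> / 2.\<close>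
  define \<delta> where "\<delta> = \<epsilon>\<^sup>2 / 8"
  have \<delta>: "\<delta> > 0" using Suc by (simp add: \<delta>_def)
  define H where "H = Suc (nat \<lceil>1 / \<delta>\<rceil>)"
  have H: "H \<ge> 1" "1 / real H \<le> \<delta>"
  proof -
    have "1 / \<delta> \<le> real H" unfolding H_def by linarith
    moreover have "real H > 0" by (simp add: H_def)
    ultimately show "1 / real H \<le> \<delta>" using \<delta> by (simp add: field_simps)
  qed (simp add: H_def)
  have "\<exists>L0. \<forall>L\<ge>L0. \<forall>f :: nat \<Rightarrow> real. (\<forall>m. (fdiff 1 ^^ Suc D) f m = real j * \<beta>) \<longrightarrow>
           norm (\<Sum>m<L. e (f m)) \<le> \<delta> * L" if "j > 0" for j
  proof (rule Suc.IH[OF _ \<delta>])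
    show "real j * \<beta> \<notin> \<rat>"
      using Suc.prems(1) that Rats_divide[of "real j * \<beta>" "real j"] by auto
  qed
  then obtain L0 where L0: "norm (\<Sum>m<L. e (f m)) \<le> \<delta> * L"
    if "j > 0" "L \<ge> L0 j" "\<forall>m. (fdiff 1 ^^ Suc D) f m = real j * \<beta>" for j L and f :: "nat \<Rightarrow> real"
    by metis
  \<comment> \<open>Only finitely many multiples of \<beta> occur, so their thresholds have a
    maximum; the second summand absorbs the boundary term 2 H into half of \<epsilon> L.\<close>
  define L1 where "L1 = Max (L0 ` {..H}) + nat \<lceil>4 * H / \<epsilon>\<rceil>"
  show ?case
  proof (intro exI[of _ L1] allI impI)
    fix L and f :: "nat \<Rightarrow> real"
    assume L: "L1 \<le> L" and f: "\<forall>m. (fdiff 1 ^^ Suc (Suc D)) f m = \<beta>"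
    have "norm (\<Sum>m<L. e (f m)) \<le> L * sqrt (1 / H + \<delta>) + 2 * real H"
    proof (rule van_der_Corput_ineq[of "\<lambda>m. e (f m)" H \<delta> L])
      fix i j assume ij: "j < i" "i < H"
      have "L0 (i - j) \<le> Max (L0 ` {..H})"
        using ij by (intro Max_ge) auto
      then have "L0 (i - j) \<le> L" using L unfolding L1_def by linarith
      moreover have "(fdiff 1 ^^ Suc D) (\<lambda>m. f (m + i) - f (m + j)) m = real (i - j) * \<beta>" for m
        using f ij by (intro funpow_fdiff_shift_diff) auto
      ultimately show "norm (\<Sum>m<L. e (f (m + i)) * cnj (e (f (m + j)))) \<le> \<delta> * L"
        using L0[of "i - j" L "\<lambda>m. f (m + i) - f (m + j)"] ij by (simp add: e_diff)
    qed (use H \<delta> in auto)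
    also have "\<dots> \<le> L * (\<epsilon> / 2) + \<epsilon> / 2 * L"
    proof (intro add_mono mult_left_mono)
      show "sqrt (1 / H + \<delta>) \<le> \<epsilon> / 2"
        using H Suc.prems by (intro real_le_lsqrt) (auto simp: \<delta>_def power2_eq_square)
      have "4 * H / \<epsilon> \<le> L" using L unfolding L1_def by linarith
      then show "2 * real H \<le> \<epsilon> / 2 * L" using Suc.prems by (simp add: field_simps)
    qed auto
    finally show "norm (\<Sum>m<L. e (f m)) \<le> \<epsilon> * L" by simp
  qed
qed

text \<open>D discrete integrations, each of which multiplies the error by at most m.\<close>

lemma fdiff_approx:
  fixes f :: "nat \<Rightarrow> real"
  assumes "\<And>m. m < L \<Longrightarrow> \<bar>(fdiff 1 ^^ D) f m - \<beta>\<bar> \<le> \<delta>"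
  shows "\<exists>g. (\<forall>m. (fdiff 1 ^^ D) g m = \<beta>) \<and> (\<forall>m<L. \<bar>f m - g m\<bar> \<le> \<delta> * real m ^ D)"
  using assms
proof (induction D arbitrary: f)
  case 0
  then show ?case by (intro exI[of _ "\<lambda>_. \<beta>"]) auto
next
  case (Suc D)
  obtain g where g: "\<And>m. (fdiff 1 ^^ D) g m = \<beta>" "\<And>m. m < L \<Longrightarrow> \<bar>fdiff 1 f m - g m\<bar> \<le> \<delta> * real m ^ D"
    using Suc.IH[of "fdiff 1 f"] Suc.prems by (auto simp: funpow_swap1 simp del: funpow.simps) (auto simp: funpow_swap1)
  \<comment> \<open>The discrete antiderivative of g with the initial value of f, so that f - G
    accumulates the errors of g.\<close>
  define G where "G m = f 0 + (\<Sum>i<m. g i)" for m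
  have "fdiff 1 G = g" by (simp add: fdiff_def G_def fun_eq_iff)
  then have "(fdiff 1 ^^ Suc D) G m = \<beta>" for m
    using g(1) by (simp add: funpow_Suc_right del: funpow.simps)
  moreover have "\<bar>f m - G m\<bar> \<le> \<delta> * real m ^ Suc D" if "m < L" for m
  proof -
    have \<delta>: "\<delta> \<ge> 0" using Suc.prems[of 0] that by fastforce
    have "f m - G m = (\<Sum>i<m. fdiff 1 f i - g i)"
      using sum_lessThan_telescope[of f m] by (simp add: G_def sum_subtractf fdiff_def)
    then have "\<bar>f m - G m\<bar> \<le> (\<Sum>i<m. \<bar>fdiff 1 f i - g i\<bar>)"
      by simp
    also have "\<dots> \<le> (\<Sum>i<m. \<delta> * real m ^ D)"
    proof (rule sum_mono)
      fix i assume "i \<in> {..<m}"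
      then have "\<bar>fdiff 1 f i - g i\<bar> \<le> \<delta> * real i ^ D" "real i ^ D \<le> real m ^ D"
        using g(2)[of i] that by (auto intro: power_mono)
      then show "\<bar>fdiff 1 f i - g i\<bar> \<le> \<delta> * real m ^ D"
        using \<delta> mult_left_mono order_trans by blast
    qed
    finally show ?thesis by (simp add: algebra_simps)
  qed
  ultimately show ?case by blast
qed

text \<open>L comes from the exact bound for \<epsilon> / 2; then \<delta> is taken so small that
  replacing f by a polynomial changes each of the L terms by at most \<epsilon> / 2. Neither depends
  on f.\<close>

corollary Weyl_perturbed:
  assumes "\<beta> \<notin> \<rat>" and "\<epsilon> > 0" and "D \<ge> 1"
  shows "\<exists>L\<ge>1. \<exists>\<delta>>0. \<forall>f :: nat \<Rightarrow> real. (\<forall>m<L. \<bar>(fdiff 1 ^^ D) f m - \<beta>\<bar> \<le> \<delta>) \<longrightarrow>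
           norm (\<Sum>m<L. e (f m)) \<le> \<epsilon> * L"
proof -
  obtain D' where D: "D = Suc D'" using assms(3) by (cases D) auto
  obtain L0 where L0: "\<And>(L::nat) (f :: nat \<Rightarrow> real). L \<ge> L0 \<Longrightarrow> \<forall>m. (fdiff 1 ^^ D) f m = \<beta> \<Longrightarrow>
      norm (\<Sum>m<L. e (f m)) \<le> \<epsilon> / 2 * L"
    using Weyl_uniform[OF assms(1) half_gt_zero[OF assms(2)], of D'] unfolding D[symmetric] by blast
  define L where "L = Suc L0"
  define \<delta> where "\<delta> = \<epsilon> / (4 * pi * real L ^ D)"
  have \<delta>: "\<delta> > 0" using assms by (simp add: \<delta>_def L_def)
  have "norm (\<Sum>m<L. e (f m)) \<le> \<epsilon> * L"
    if f: "\<forall>m<L. \<bar>(fdiff 1 ^^ D) f m - \<beta>\<bar> \<le> \<delta>" for f :: "nat \<Rightarrow> real"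
  proof -
    obtain g where g: "\<forall>m. (fdiff 1 ^^ D) g m = \<beta>" "\<forall>m<L. \<bar>f m - g m\<bar> \<le> \<delta> * real m ^ D"
      using fdiff_approx[of L D f \<beta> \<delta>] f by blast
    have "norm ((\<Sum>m<L. e (f m)) - (\<Sum>m<L. e (g m))) \<le> (\<Sum>m<L. \<epsilon> / 2)"
      unfolding sum_subtractf[symmetric]
    proof (rule sum_norm_le)
      fix m assume m: "m \<in> {..<L}"
      have "norm (e (f m) - e (g m)) \<le> 2 * pi * \<bar>f m - g m\<bar>" by (rule norm_e_diff_le)
      also have "\<dots> \<le> 2 * pi * (\<delta> * real L ^ D)"
      proof (intro mult_left_mono)
        have "\<bar>f m - g m\<bar> \<le> \<delta> * real m ^ D" using g m by auto
        also have "\<dots> \<le> \<delta> * real L ^ D" using \<delta> m by (intro mult_left_mono power_mono) auto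
        finally show "\<bar>f m - g m\<bar> \<le> \<delta> * real L ^ D" .
      qed auto
      also have "\<dots> = \<epsilon> / 2" by (simp add: \<delta>_def L_def)
      finally show "norm (e (f m) - e (g m)) \<le> \<epsilon> / 2" .
    qed
    moreover have "norm (\<Sum>m<L. e (g m)) \<le> \<epsilon> / 2 * L"
      by (rule L0) (use g in \<open>auto simp: L_def\<close>)
    ultimately show ?thesis
      using norm_triangle_sub[of "\<Sum>m<L. e (f m)" "\<Sum>m<L. e (g m)"] by (simp add: mult.commute)
  qed
  then show ?thesis using \<delta> by (intro exI[of _ L] conjI exI[of _ \<delta>]) (auto simp: L_def)
qed

section \<open>Short averages of slowly varying phases\<close>

text \<open>Differencing commutes with differentiation, so the induction replaces the whole chain G
  by its differences. This is why a chain of derivatives is carried along.\<close>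

lemma fdiff_mean_value:
  fixes G :: "nat \<Rightarrow> real \<Rightarrow> real"
  assumes "\<And>i x. i < D \<Longrightarrow> x \<ge> X \<Longrightarrow> (G i has_real_derivative G (Suc i) x) (at x)"
    and q: "q > 0" and "x \<ge> X"
  shows "\<exists>\<xi>\<ge>x. \<xi> \<le> x + real D * q \<and> (fdiff q ^^ D) (G 0) x = q ^ D * G D \<xi>"
  using assms(1,3)
proof (induction D arbitrary: G x)
  case 0
  then show ?case by auto
next
  case (Suc D)
  have "\<exists>\<xi>\<ge>x. \<xi> \<le> x + real D * q \<and>
      (fdiff q ^^ D) (fdiff q (G 0)) x = q ^ D * fdiff q (G D) \<xi>"
  proof (rule Suc.IH)
    fix i y assume i: "i < D" and y: "y \<ge> X"
    have "(G i has_real_derivative G (Suc i) (y + q)) (at (y + q))"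
      using Suc.prems(1)[of i "y + q"] i y q by simp
    then have "((\<lambda>y. G i (y + q)) has_real_derivative G (Suc i) (y + q)) (at y)"
      by (simp add: DERIV_shift)
    moreover have "(G i has_real_derivative G (Suc i) y) (at y)"
      using Suc.prems(1)[of i y] i y by simp
    ultimately show "(fdiff q (G i) has_real_derivative fdiff q (G (Suc i)) y) (at y)"
      unfolding fdiff_def[abs_def] by (rule DERIV_diff)
  qed (use Suc.prems in auto)
  then obtain \<xi> where \<xi>: "\<xi> \<ge> x" "\<xi> \<le> x + real D * q"
    "(fdiff q ^^ D) (fdiff q (G 0)) x = q ^ D * fdiff q (G D) \<xi>" by blast
  obtain \<eta> where \<eta>: "\<xi> < \<eta>" "\<eta> < \<xi> + q" "G D (\<xi> + q) - G D \<xi> = (\<xi> + q - \<xi>) * G (Suc D) \<eta>"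
    using MVT2[of \<xi> "\<xi> + q" "G D" "G (Suc D)"] Suc.prems \<xi>(1) q by force
  have "(fdiff q ^^ Suc D) (G 0) x = q ^ Suc D * G (Suc D) \<eta>"
    using \<xi>(3) \<eta>(3) by (simp add: funpow_Suc_right fdiff_def del: funpow.simps)
  moreover have "x \<le> \<eta>" "\<eta> \<le> x + real (Suc D) * q"
    using \<xi> \<eta> by (auto simp: algebra_simps)
  ultimately show ?case by blast
qed

lemma funpow_fdiff_progression:
  fixes g :: "real \<Rightarrow> real"
  shows "(fdiff 1 ^^ D) (\<lambda>m. g (x + q * real m)) m = (fdiff q ^^ D) g (x + q * real m)"
  by (induction D arbitrary: m) (simp_all add: fdiff_def algebra_simps)

lemma sum_lessThan_mult:
  fixes F :: "nat \<Rightarrow> 'a::comm_monoid_add"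
  shows "(\<Sum>n<L * q. F n) = (\<Sum>r<q. \<Sum>m<L. F (r + q * m))"
proof -
  have "(\<Sum>n<L * q. F n) = (\<Sum>m<L. \<Sum>n\<in>{m * q..<m * q + q}. F n)"
    by (simp add: sum.nat_group)
  also have "\<dots> = (\<Sum>m<L. \<Sum>r<q. F (r + q * m))"
  proof (rule sum.cong)
    fix m
    have "(\<Sum>n\<in>{0 + m * q..<q + m * q}. F n) = (\<Sum>r\<in>{0..<q}. F (r + m * q))"
      by (rule sum.shift_bounds_nat_ivl)
    then show "(\<Sum>n\<in>{m * q..<m * q + q}. F n) = (\<Sum>r<q. F (r + q * m))"
      by (simp add: add.commute mult.commute lessThan_atLeast0)
  qed simp
  also have "\<dots> = (\<Sum>r<q. \<Sum>m<L. F (r + q * m))"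
    by (rule sum.swap)
  finally show ?thesis .
qed

text \<open>
  Along a progression of step \<^term>\<open>q b\<close> the phase differs from a polynomial with the
  irrational leading coefficient \<open>\<beta> / fact D\<close> by little, and \<^term>\<open>w\<close> is constant modulo 1.
\<close>

lemma block_sum_bound:
  fixes G :: "nat \<Rightarrow> real \<Rightarrow> real" and q :: "nat \<Rightarrow> nat" and w :: "nat \<Rightarrow> real"
  assumes D: "D \<ge> 1" and \<beta>: "\<beta> \<notin> \<rat>" and \<epsilon>: "\<epsilon> > 0"
    and der: "\<And>i x. i < D \<Longrightarrow> x \<ge> X \<Longrightarrow> (G i has_real_derivative G (Suc i) x) (at x)"
    and q: "\<And>b. q b \<ge> 1"
    and lim: "\<And>(L::nat) \<delta>. \<delta> > 0 \<Longrightarrow> \<forall>\<^sub>F b in sequentially.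
        \<forall>x. real b - real L * real (q b) \<le> x \<longrightarrow> x \<le> real b + real L * real (q b) \<longrightarrow>
          \<bar>real (q b) ^ D * G D x - \<beta>\<bar> \<le> \<delta>"
    and small: "(\<lambda>b. real (q b) / real b) \<longlonglongrightarrow> 0"
    and w: "\<And>b n m. w (n + q b * m) - w n \<in> \<int>"
  shows "\<exists>L::nat. L \<ge> 1 \<and> (\<forall>\<^sub>F b in sequentially. L * q b \<le> b \<and>
      norm (\<Sum>n\<in>{b - L * q b..<b}. e (w n + G 0 (real n))) \<le> \<epsilon> * real (L * q b))"
proof -
  obtain L \<delta> where L: "L \<ge> 1" and \<delta>: "\<delta> > 0" and
    W: "\<And>f :: nat \<Rightarrow> real. \<forall>m<L. \<bar>(fdiff 1 ^^ D) f m - \<beta>\<bar> \<le> \<delta> \<Longrightarrow> norm (\<Sum>m<L. e (f m)) \<le> \<epsilon> * L"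
    using Weyl_perturbed[OF \<beta> \<epsilon> D] by blast
  \<comment> \<open>With q b / b below 1 / (2 L) the block ending at b lies above b / 2, hence above
    X as soon as b is at least 2 X.\<close>
  have ev1: "\<forall>\<^sub>F b in sequentially. real (q b) / real b < 1 / (2 * real L)"
    using small by (rule order_tendstoD) (use L in simp)
  have ev2: "\<forall>\<^sub>F b in sequentially. real b \<ge> max 1 (2 * X)"
    using filterlim_real_sequentially unfolding filterlim_at_top by blast
  have "\<forall>\<^sub>F b in sequentially. L * q b \<le> b \<and>
      norm (\<Sum>n\<in>{b - L * q b..<b}. e (w n + G 0 (real n))) \<le> \<epsilon> * real (L * q b)"
    \<comment> \<open>The window is widened from L to L + D steps, because the mean value point may
      lie up to D steps to the right of its base point.\<close>
    using ev1 ev2 lim[OF \<delta>, of "L + D"]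
  proof eventually_elim
    case (elim b)
    have "2 * (real L * real (q b)) < real b"
      using elim(1,2) L by (simp add: field_simps)
    then have Lq: "L * q b \<le> b" and X: "X \<le> real b - real L * real (q b)"
      using elim(2) by (simp_all flip: of_nat_mult)
    define a where "a = b - L * q b"
    have a: "real a = real b - real L * real (q b)" "{a..<b} = {0 + a..<L * q b + a}"
      using Lq by (simp_all add: a_def of_nat_diff)
    have prog: "norm (\<Sum>m<L. e (w (r + q b * m + a) + G 0 (real (r + q b * m + a)))) \<le> \<epsilon> * L"
      if r: "r < q b" for r
    proof -
      define x where "x = real (r + a)"
      have "norm (\<Sum>m<L. e (w (r + q b * m + a) + G 0 (real (r + q b * m + a))))
          = norm (\<Sum>m<L. e (w (r + a)) * e (G 0 (x + real (q b) * real m)))"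
      proof (intro arg_cong[where f=norm] sum.cong refl)
        fix m
        \<comment> \<open>Along the progression w changes by integers, which e does not see; what
          remains of w is a constant factor of modulus 1.\<close>
        have "w (r + q b * m + a) + G 0 (real (r + q b * m + a))
            = (w (r + a + q b * m) - w (r + a)) + (w (r + a) + G 0 (x + real (q b) * real m))"
          by (simp add: x_def add_ac)
        then show "e (w (r + q b * m + a) + G 0 (real (r + q b * m + a)))
            = e (w (r + a)) * e (G 0 (x + real (q b) * real m))"
          using e_Ints[OF w[of "r + a" b m]] by (simp only: e_add) simp
      qed
      also have "\<dots> = norm (\<Sum>m<L. e (G 0 (x + real (q b) * real m)))"
        by (simp add: norm_mult flip: sum_distrib_left)
      also have "\<dots> \<le> \<epsilon> * L"
      proof (rule W, intro allI impI)
        fix m assume m: "m < L"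
        define y where "y = x + real (q b) * real m"
        have y: "y \<ge> real b - real L * real (q b)"
          by (simp add: y_def x_def a)
        obtain \<xi> where \<xi>: "\<xi> \<ge> y" "\<xi> \<le> y + real D * real (q b)"
          "(fdiff (real (q b)) ^^ D) (G 0) y = real (q b) ^ D * G D \<xi>"
          using fdiff_mean_value[of D X G "real (q b)" y, OF der] q[of b] X y by force
        have "real (r + q b * m) \<le> real (q b * L)"
        proof -
          have "r + q b * m \<le> q b * Suc m" using r by simp
          also have "\<dots> \<le> q b * L" using m by (intro mult_le_mono) auto
          finally show ?thesis by (simp only: of_nat_le_iff)
        qed
        then have "y \<le> real b" by (simp add: y_def x_def a algebra_simps)
        then have "\<xi> \<le> real b + real (L + D) * real (q b)"
          using \<xi>(2) by (simp add: algebra_simps) (smt (verit) mult_nonneg_nonneg of_nat_0_le_iff)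
        moreover have "real b - real (L + D) * real (q b) \<le> \<xi>"
          using \<xi>(1) y by (simp add: algebra_simps) (smt (verit) mult_nonneg_nonneg of_nat_0_le_iff)
        ultimately have "\<bar>real (q b) ^ D * G D \<xi> - \<beta>\<bar> \<le> \<delta>"
          using elim(3) by blast
        then show "\<bar>(fdiff 1 ^^ D) (\<lambda>m. G 0 (x + real (q b) * real m)) m - \<beta>\<bar> \<le> \<delta>"
          using \<xi>(3) by (simp only: funpow_fdiff_progression y_def)
      qed
      finally show ?thesis .
    qed
    have "(\<Sum>n\<in>{a..<b}. e (w n + G 0 (real n))) = (\<Sum>n<L * q b. e (w (n + a) + G 0 (real (n + a))))"
      unfolding a(2) by (subst sum.shift_bounds_nat_ivl) (simp add: lessThan_atLeast0)
    also have "\<dots> = (\<Sum>r<q b. \<Sum>m<L. e (w (r + q b * m + a) + G 0 (real (r + q b * m + a))))"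
      by (rule sum_lessThan_mult)
    also have "norm \<dots> \<le> (\<Sum>r<q b. \<epsilon> * L)"
      using prog by (intro sum_norm_le) auto
    finally show ?case
      using Lq by (simp add: a_def mult_ac)
  qed
  then show ?thesis using L by blast
qed

text \<open>Blocks are cut off from the right, since the length of a block is tied to its right
  endpoint. What is left over is shorter than a block or lies below B. The middle summand vanishes
  for b \<le> B because t is known to be monotone only from B on, and the bound at b has to dominate
  the one at b - t b.\<close>

lemma tiling_bound:
  fixes z :: "nat \<Rightarrow> complex" and t :: "nat \<Rightarrow> nat" and \<epsilon> :: real
  assumes z: "\<And>n. norm (z n) \<le> 1" and \<epsilon>: "\<epsilon> \<ge> 0"
    and t: "\<And>b. b \<ge> B \<Longrightarrow> t b \<ge> 1" "\<And>b. b \<ge> B \<Longrightarrow> t b \<le> b"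
    and mono: "\<And>b b'. B \<le> b \<Longrightarrow> b \<le> b' \<Longrightarrow> t b \<le> t b'"
    and block: "\<And>b. b \<ge> B \<Longrightarrow> norm (\<Sum>n\<in>{b - t b..<b}. z n) \<le> \<epsilon> * t b"
  shows "norm (\<Sum>n\<in>{a..<b}. z n) \<le> \<epsilon> * real (b - a) + (if b \<le> B then 0 else real (t b)) + real B"
proof (induction b rule: less_induct)
  case (less b)
  have triv: "norm (\<Sum>n\<in>{a..<b}. z n) \<le> real (b - a)"
    using sum_norm_le[of "{a..<b}" z "\<lambda>_. 1"] z by simp
  consider "b \<le> B" | "b > B" "b - a \<le> t b" | "b > B" "t b < b - a" by linarith
  then show ?case
  proof cases
    case 1
    then have "real (b - a) \<le> real B" by simp
    then show ?thesis using triv 1 \<epsilon> by (simp add: add_increasing)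
  next
    case 2
    then have "real (b - a) \<le> real (t b)" by simp
    moreover have "0 \<le> \<epsilon> * real (b - a)" using \<epsilon> by simp
    ultimately show ?thesis using triv 2 by simp
  next
    case 3
    define b' where "b' = b - t b"
    have b': "b' < b" "a \<le> b'" "b' \<le> b" "b - a = (b' - a) + t b"
      using 3 t[of b] by (auto simp: b'_def)
    have "(\<Sum>n\<in>{a..<b}. z n) = (\<Sum>n\<in>{a..<b'}. z n) + (\<Sum>n\<in>{b'..<b}. z n)"
      using b' by (simp add: sum.atLeastLessThan_concat)
    then have "norm (\<Sum>n\<in>{a..<b}. z n) \<le> norm (\<Sum>n\<in>{a..<b'}. z n) + norm (\<Sum>n\<in>{b'..<b}. z n)"
      by (simp add: norm_triangle_ineq)
    also have "\<dots> \<le> (\<epsilon> * real (b' - a) + (if b' \<le> B then 0 else real (t b')) + real B) + \<epsilon> * t b"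
      using less.IH[OF b'(1)] block[of b] 3 unfolding b'_def by (intro add_mono) auto
    also have "\<dots> \<le> \<epsilon> * real (b - a) + real (t b) + real B"
      using mono[of b' b] b'(3) unfolding b'(4) of_nat_add distrib_left by auto
    finally show ?thesis using 3 by simp
  qed
qed

text \<open>In the tiling bound the main term gives \<epsilon> / 2 and the rest is a constant times
  q N. The number L may grow as \<epsilon> shrinks; this is harmless because s N eventually exceeds
  every fixed multiple of q N.\<close>

lemma avg_tendsto_0:
  fixes z :: "nat \<Rightarrow> complex" and q s :: "nat \<Rightarrow> nat"
  assumes z: "\<And>n. norm (z n) \<le> 1" and q: "\<And>b. q b \<ge> 1"
    and mono: "\<And>b b'. B0 \<le> b \<Longrightarrow> b \<le> b' \<Longrightarrow> q b \<le> q b'"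
    and block: "\<And>\<epsilon>. \<epsilon> > 0 \<Longrightarrow> \<exists>L::nat. L \<ge> 1 \<and> (\<forall>\<^sub>F b in sequentially. L * q b \<le> b \<and>
      norm (\<Sum>n\<in>{b - L * q b..<b}. z n) \<le> \<epsilon> * real (L * q b))"
    and s: "filterlim (\<lambda>N. real (s N) / real (q N)) at_top sequentially"
  shows "(\<lambda>N. avg (int N - int (s N)) (int N) z) \<longlonglongrightarrow> 0"
proof (rule tendstoI)
  fix \<epsilon> :: real assume \<epsilon>: "\<epsilon> > 0"
  obtain L :: nat and B1 where L: "L \<ge> 1" and B1: "\<And>b. b \<ge> B1 \<Longrightarrow> L * q b \<le> b"
      "\<And>b. b \<ge> B1 \<Longrightarrow> norm (\<Sum>n\<in>{b - L * q b..<b}. z n) \<le> \<epsilon> / 2 * real (L * q b)"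
    using block[of "\<epsilon> / 2"] \<epsilon> unfolding eventually_sequentially by auto
  define B where "B = max B0 B1"
  define C where "C = 1 + real L + real B"
  have bound: "norm (\<Sum>n\<in>{a..<b}. z n) \<le> \<epsilon> / 2 * real (b - a) + real (L * q b) + real B" for a b
  proof -
    have "norm (\<Sum>n\<in>{a..<b}. z n) \<le> \<epsilon> / 2 * real (b - a) + (if b \<le> B then 0 else real (L * q b)) + real B"
    proof (rule tiling_bound)
      show "L * q b \<ge> 1" for b using L q[of b] by simp
      show "L * q b \<le> L * q b'" if "B \<le> b" "b \<le> b'" for b b'
        using mono[of b b'] that by (simp add: B_def)
    qed (use z \<epsilon> B1 in \<open>auto simp: B_def simp del: of_nat_mult\<close>)
    also have "\<dots> \<le> \<epsilon> / 2 * real (b - a) + real (L * q b) + real B"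
      by (auto simp del: of_nat_mult)
    finally show ?thesis .
  qed
  have "\<forall>\<^sub>F N in sequentially. real (s N) / real (q N) > 2 * C / \<epsilon>"
    using s unfolding filterlim_at_top_dense by blast
  then show "\<forall>\<^sub>F N in sequentially. dist (avg (int N - int (s N)) (int N) z) 0 < \<epsilon>"
    using eventually_ge_at_top[of 1]
  proof eventually_elim
    case (elim N)
    have qN: "real (q N) \<ge> 1" using q[of N] by simp
    have "C > 0" by (simp add: C_def)
    have sN: "2 * C * real (q N) < \<epsilon> * real (s N)"
      using elim(1) \<epsilon> qN by (simp add: field_simps)
    then have "0 < \<epsilon> * real (s N)"
      using \<open>C > 0\<close> qN by (smt (verit) mult_nonneg_nonneg)
    then have s0: "real (s N) > 0" using \<epsilon> by (simp add: zero_less_mult_iff)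
    \<comment> \<open>The averaging interval is closed, so its endpoint N is split off; the 1 in C
      pays for it. Truncated subtraction and the maximum clip the interval at 1.\<close>
    define a where "a = max 1 (N - s N)"
    have "{n::nat. 1 \<le> n \<and> int N - int (s N) \<le> int n \<and> int n \<le> int N} = insert N {a..<N}"
      using elim(2) by (auto simp: a_def)
    then have "avg (int N - int (s N)) (int N) z = (z N + (\<Sum>n\<in>{a..<N}. z n)) / of_nat (s N)"
      by (simp add: avg_def)
    then have "norm (avg (int N - int (s N)) (int N) z)
        = norm (z N + (\<Sum>n\<in>{a..<N}. z n)) / real (s N)"
      by (simp add: norm_divide)
    also have "norm (z N + (\<Sum>n\<in>{a..<N}. z n)) \<le> 1 + (\<epsilon> / 2 * real (N - a) + real (L * q N) + real B)"
      by (rule norm_triangle_mono[OF z bound])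
    also have "\<dots> \<le> \<epsilon> / 2 * real (s N) + C * real (q N)"
    proof -
      have "\<epsilon> / 2 * real (N - a) \<le> \<epsilon> / 2 * real (s N)"
        using \<epsilon> by (intro mult_left_mono) (auto simp: a_def)
      moreover have "1 \<le> 1 * real (q N)" "real B \<le> real B * real (q N)"
        using mult_left_mono[OF qN, of "real B"] qN by simp_all
      ultimately show ?thesis unfolding C_def distrib_right by simp
    qed
    also have "\<dots> < \<epsilon> / 2 * real (s N) + \<epsilon> / 2 * real (s N)"
      using sN by simp
    finally show ?case using s0 by (simp add: divide_simps dist_norm split: if_splits)
  qed
qed

section \<open>Hardy fields and their extensions\<close>

text \<open>The property behind both field structure and asymptotics: it separates the zero germ
  from functions that eventually have no zeros, and applied to a derivative it yields monotonicity
  and limits.\<close>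

definition eventually_signed :: "(real \<Rightarrow> real) \<Rightarrow> bool" where
  "eventually_signed f \<longleftrightarrow> (\<forall>\<^sub>F x in at_top. f x = 0) \<or> (\<forall>\<^sub>F x in at_top. f x > 0) \<or> (\<forall>\<^sub>F x in at_top. f x < 0)"

lemma eventually_signed_uminus: "eventually_signed (\<lambda>x. - f x) \<longleftrightarrow> eventually_signed f"
  by (auto simp: eventually_signed_def)

lemma eventually_signed_cong:
  assumes "\<forall>\<^sub>F x in at_top. f x = g x"
  shows "eventually_signed f \<longleftrightarrow> eventually_signed g"
proof -
  have "(\<forall>\<^sub>F x in at_top. f x = 0) \<longleftrightarrow> (\<forall>\<^sub>F x in at_top. g x = 0)"
    "(\<forall>\<^sub>F x in at_top. f x > 0) \<longleftrightarrow> (\<forall>\<^sub>F x in at_top. g x > 0)"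
    "(\<forall>\<^sub>F x in at_top. f x < 0) \<longleftrightarrow> (\<forall>\<^sub>F x in at_top. g x < 0)"
    using assms by (auto intro!: eventually_subst elim: eventually_mono)
  then show ?thesis by (simp add: eventually_signed_def)
qed

lemma eventually_signed_if_nonzero:
  assumes "\<forall>\<^sub>F x in at_top. f differentiable (at x)" and "\<forall>\<^sub>F x in at_top. f x \<noteq> 0"
  shows "eventually_signed f"
proof -
  obtain X where X: "\<And>x. x \<ge> X \<Longrightarrow> f differentiable (at x) \<and> f x \<noteq> (0::real)"
    using eventually_conj[OF assms] unfolding eventually_at_top_linorder by auto
  have cont: "continuous_on {X..x} f" for x
    using X by (intro continuous_at_imp_continuous_on) (auto intro: differentiable_imp_continuous_within)
  show ?thesis
  proof (cases "f X > 0")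
    case True
    have "f x > 0" if "x \<ge> X" for x
      using IVT2'[of f x 0 X] cont[of x] X that True by force
    then show ?thesis unfolding eventually_signed_def eventually_at_top_linorder by blast
  next
    case False
    have "f x < 0" if "x \<ge> X" for x
      using IVT'[of f X 0 x] cont[of x] X that False by force
    then show ?thesis unfolding eventually_signed_def eventually_at_top_linorder by blast
  qed
qed

lemma eventually_nondecreasing:
  assumes "\<forall>\<^sub>F x in at_top. (f has_real_derivative f' x) (at x)" and "\<forall>\<^sub>F x in at_top. f' x \<ge> 0"
  shows "\<exists>X. \<forall>x\<ge>X. \<forall>y\<ge>x. f x \<le> f y"
proof -
  obtain X where X: "\<And>x. x \<ge> X \<Longrightarrow> (f has_real_derivative f' x) (at x) \<and> f' x \<ge> 0"
    using eventually_conj[OF assms] unfolding eventually_at_top_linorder by auto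
  have "f x \<le> f y" if "X \<le> x" "x \<le> y" for x y
  proof (rule DERIV_nonneg_imp_nondecreasing[OF that(2)])
    fix z assume "x \<le> z"
    then show "\<exists>l. (f has_real_derivative l) (at z) \<and> 0 \<le> l"
      using X[of z] that by auto
  qed
  then show ?thesis by blast
qed

lemma eventually_signed_nondecreasing:
  fixes f :: "real \<Rightarrow> real"
  assumes X: "\<forall>x\<ge>X. \<forall>y\<ge>x. f x \<le> f y"
  shows "eventually_signed f"
proof -
  consider x where "x \<ge> X" "f x > 0" | x where "x \<ge> X" "f x = 0" "\<forall>x\<ge>X. f x \<le> 0" | "\<forall>x\<ge>X. f x < 0"
    by (metis linorder_less_linear not_less)
  then show ?thesis
  proof cases
    case (1 x)
    then have "\<forall>y\<ge>x. f y > 0" using X by (meson less_le_trans)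
    then show ?thesis unfolding eventually_signed_def eventually_at_top_linorder by blast
  next
    case (2 x)
    then have "\<forall>y\<ge>x. f y = 0" using X by (metis order.antisym order.trans)
    then show ?thesis unfolding eventually_signed_def eventually_at_top_linorder by blast
  next
    case 3
    then show ?thesis unfolding eventually_signed_def eventually_at_top_linorder by blast
  qed
qed

lemma eventually_signed_cases:
  assumes "eventually_signed f"
  obtains "\<forall>\<^sub>F x in at_top. f x \<ge> 0" | "\<forall>\<^sub>F x in at_top. f x \<le> 0"
proof -
  have "(\<forall>\<^sub>F x in at_top. f x \<ge> 0) \<or> (\<forall>\<^sub>F x in at_top. f x \<le> 0)"
    using assms unfolding eventually_signed_def
    by (elim disjE) (simp_all add: eventually_mono less_imp_le)
  then show ?thesis using that by blast
qed

text \<open>A derivative of eventual sign makes f eventually monotone, and a monotone function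
  settles on one sign.\<close>

lemma eventually_signed_if_deriv:
  assumes d: "\<forall>\<^sub>F x in at_top. (f has_real_derivative f' x) (at x)" and s: "eventually_signed f'"
  shows "eventually_signed f"
  using s
proof (cases rule: eventually_signed_cases)
  case 1
  then show ?thesis
    using eventually_nondecreasing[OF d] eventually_signed_nondecreasing by blast
next
  case 2
  have "\<forall>\<^sub>F x in at_top. ((\<lambda>x. - f x) has_real_derivative - f' x) (at x)"
    using d by (auto elim!: eventually_mono intro: DERIV_minus)
  then have "eventually_signed (\<lambda>x. - f x)"
    using eventually_nondecreasing[of "\<lambda>x. - f x" "\<lambda>x. - f' x"] 2 eventually_signed_nondecreasing by auto
  then show ?thesis by (simp add: eventually_signed_uminus)
qed

lemma nondecreasing_limit:
  fixes f :: "real \<Rightarrow> real"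
  assumes X: "\<forall>x\<ge>X. \<forall>y\<ge>x. f x \<le> f y"
  shows "(\<exists>l. (f \<longlongrightarrow> l) at_top) \<or> filterlim f at_top at_top"
proof (cases "bdd_above (f ` {X..})")
  case True
  have "(f \<longlongrightarrow> Sup (f ` {X..})) at_top"
  proof (rule increasing_tendsto)
    show "\<forall>\<^sub>F x in at_top. f x \<le> Sup (f ` {X..})"
      unfolding eventually_at_top_linorder using True by (intro exI[of _ X]) (auto intro: cSup_upper)
    fix y assume "y < Sup (f ` {X..})"
    then obtain x where "x \<ge> X" "y < f x"
      using less_cSup_iff[of "f ` {X..}" y] True by auto
    then show "\<forall>\<^sub>F x in at_top. y < f x"
      unfolding eventually_at_top_linorder using X by (meson less_le_trans)
  qed
  then show ?thesis by blast
next
  case False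
  have "filterlim f at_top at_top"
    unfolding filterlim_at_top
  proof
    fix Z
    obtain x where "x \<ge> X" "f x > Z"
      using False unfolding bdd_above_def by (auto simp: not_le)
    then show "\<forall>\<^sub>F x in at_top. Z \<le> f x"
      unfolding eventually_at_top_linorder using X by (meson less_imp_le order.trans)
  qed
  then show ?thesis by blast
qed

lemma limit_if_deriv_signed:
  assumes d: "\<forall>\<^sub>F x in at_top. (f has_real_derivative f' x) (at x)" and s: "eventually_signed f'"
  shows "(\<exists>l. (f \<longlongrightarrow> l) at_top) \<or> filterlim f at_top at_top \<or> filterlim (\<lambda>x. - f x) at_top at_top"
  using s
proof (cases rule: eventually_signed_cases)
  case 1
  then show ?thesis
    using eventually_nondecreasing[OF d] nondecreasing_limit by blast
next
  case 2
  have "\<forall>\<^sub>F x in at_top. ((\<lambda>x. - f x) has_real_derivative - f' x) (at x)"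
    using d by (auto elim!: eventually_mono intro: DERIV_minus)
  then have "(\<exists>l. ((\<lambda>x. - f x) \<longlongrightarrow> l) at_top) \<or> filterlim (\<lambda>x. - f x) at_top at_top"
    using eventually_nondecreasing[of "\<lambda>x. - f x" "\<lambda>x. - f' x"] 2 nondecreasing_limit[of _ "\<lambda>x. - f x"]
    by auto
  then show ?thesis using tendsto_minus_cancel_left by blast
qed

text \<open>Integration of an inequality without integrals: g - f is eventually nondecreasing. The
  asymptotic bounds below come from it, each at the price of a constant.\<close>

lemma eventually_le_if_deriv_le:
  assumes "\<forall>\<^sub>F x in at_top. (f has_real_derivative f' x) (at x)"
    and "\<forall>\<^sub>F x in at_top. (g has_real_derivative g' x) (at x)"
    and "\<forall>\<^sub>F x in at_top. f' x \<le> (g' x :: real)"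
  shows "\<exists>C. \<forall>\<^sub>F x in at_top. f x \<le> g x + C"
proof -
  have "\<forall>\<^sub>F x in at_top. ((\<lambda>x. g x - f x) has_real_derivative g' x - f' x) (at x)"
    using assms(1,2) by eventually_elim (rule DERIV_diff)
  moreover have "\<forall>\<^sub>F x in at_top. g' x - f' x \<ge> 0"
    using assms(3) by eventually_elim simp
  ultimately obtain X where "\<forall>x\<ge>X. \<forall>y\<ge>x. g x - f x \<le> g y - f y"
    using eventually_nondecreasing[of "\<lambda>x. g x - f x" "\<lambda>x. g' x - f' x"] by blast
  then have "\<forall>y\<ge>X. f y \<le> g y + (f X - g X)" by force
  then show ?thesis unfolding eventually_at_top_linorder by blast
qed

section \<open>Closure, sign and limit properties of Hardy fields\<close>

locale hardy =
  fixes H :: "(real \<Rightarrow> real) set"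
  assumes hardy: "hardy_field H"
begin

lemma cong: "f \<in> H \<Longrightarrow> \<forall>\<^sub>F x in at_top. g x = f x \<Longrightarrow> g \<in> H"
  and add: "f \<in> H \<Longrightarrow> g \<in> H \<Longrightarrow> (\<lambda>x. f x + g x) \<in> H"
  and uminus: "f \<in> H \<Longrightarrow> (\<lambda>x. - f x) \<in> H"
  and mult: "f \<in> H \<Longrightarrow> g \<in> H \<Longrightarrow> (\<lambda>x. f x * g x) \<in> H"
  and zero: "(\<lambda>_. 0) \<in> H"
  and one: "(\<lambda>_. 1) \<in> H"
  and deriv: "f \<in> H \<Longrightarrow> deriv f \<in> H"
  and differentiable: "f \<in> H \<Longrightarrow> \<forall>\<^sub>F x in at_top. f differentiable (at x)"
  using hardy unfolding hardy_field_def by metis+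

lemma inverse_ex:
  "f \<in> H \<Longrightarrow> \<not> (\<forall>\<^sub>F x in at_top. f x = 0) \<Longrightarrow> \<exists>g\<in>H. \<forall>\<^sub>F x in at_top. f x * g x = 1"
  using hardy unfolding hardy_field_def by metis

lemma has_deriv: "f \<in> H \<Longrightarrow> \<forall>\<^sub>F x in at_top. (f has_real_derivative deriv f x) (at x)"
  using differentiable[of f] by (auto elim!: eventually_mono simp: DERIV_deriv_iff_real_differentiable)

lemma diff: "f \<in> H \<Longrightarrow> g \<in> H \<Longrightarrow> (\<lambda>x. f x - g x) \<in> H"
  using add[OF _ uminus, of f g] by simp

lemma power: "f \<in> H \<Longrightarrow> (\<lambda>x. f x ^ n) \<in> H"
  by (induction n) (auto intro: one mult)

lemma const_of_nat: "(\<lambda>_. real n) \<in> H"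
  by (induction n) (auto intro: zero one add)

text \<open>A nonzero element has a reciprocal, so it eventually has no zeros; continuity then fixes
  its sign.\<close>

lemma signed: "f \<in> H \<Longrightarrow> eventually_signed f"
proof (cases "\<forall>\<^sub>F x in at_top. f x = 0")
  case False
  assume f: "f \<in> H"
  then obtain g where "\<forall>\<^sub>F x in at_top. f x * g x = 1"
    using inverse_ex False by blast
  then have "\<forall>\<^sub>F x in at_top. f x \<noteq> 0"
    by (auto elim!: eventually_mono)
  then show ?thesis
    using differentiable[OF f] by (rule eventually_signed_if_nonzero[rotated])
qed (simp add: eventually_signed_def)

lemma divide: "f \<in> H \<Longrightarrow> g \<in> H \<Longrightarrow> (\<lambda>x. f x / g x) \<in> H"
proof (cases "\<forall>\<^sub>F x in at_top. g x = 0")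
  \<comment> \<open>Division by a zero germ gives zero by convention, and zero lies in H.\<close>
  case True
  then show ?thesis by (intro cong[OF zero]) (auto elim!: eventually_mono)
next
  case False
  assume f: "f \<in> H" and g: "g \<in> H"
  then obtain i where i: "i \<in> H" "\<forall>\<^sub>F x in at_top. g x * i x = 1"
    using inverse_ex False by blast
  show ?thesis
  proof (rule cong[OF mult[OF f i(1)]])
    show "\<forall>\<^sub>F x in at_top. f x / g x = f x * i x"
      using i(2) by eventually_elim (metis divide_divide_eq_right divide_inverse div_by_1 inverse_unique mult.commute)
  qed
qed

text \<open>A Hardy field contains the rational constants but need not contain other reals. This is
  why exponents and coefficients are kept rational wherever membership in H matters.\<close>

lemma const_Rats: "c \<in> \<rat> \<Longrightarrow> (\<lambda>_. c) \<in> H"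
proof -
  assume "c \<in> \<rat>"
  then obtain m n where "n \<noteq> 0" and c: "\<bar>c\<bar> = real m / real n"
    by (rule Rats_abs_nat_div_natE)
  have "(\<lambda>_. \<bar>c\<bar>) \<in> H"
    unfolding c by (intro divide const_of_nat)
  then show ?thesis
    using uminus[of "\<lambda>_. \<bar>c\<bar>"] by (cases "c \<ge> 0") auto
qed

lemma limit:
  "f \<in> H \<Longrightarrow> (\<exists>l. (f \<longlongrightarrow> l) at_top) \<or> filterlim f at_top at_top \<or> filterlim (\<lambda>x. - f x) at_top at_top"
  by (rule limit_if_deriv_signed[OF has_deriv signed[OF deriv]])

lemma funpow_deriv: "f \<in> H \<Longrightarrow> (deriv ^^ n) f \<in> H"
  by (induction n) (auto intro: deriv)

end

text \<open>E is a positive solution of the homogeneous equation and serves as an integrating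
  factor. It is used only to study signs and need not belong to the extension.\<close>

locale hardy_extension = hardy H for H +
  fixes y a b E :: "real \<Rightarrow> real"
  assumes a: "a \<in> H" and b: "b \<in> H"
    and y_deriv: "\<forall>\<^sub>F x in at_top. (y has_real_derivative a x * y x + b x) (at x)"
    and E_deriv: "\<forall>\<^sub>F x in at_top. (E has_real_derivative a x * E x) (at x)"
    and E_pos: "\<forall>\<^sub>F x in at_top. E x > 0"
begin

text \<open>Polynomials in y over H, taken as functions: y may be algebraic over H, and then the
  coefficients are not determined. The bound n is strict, so \<open>pol 0\<close> consists of the
  zero function, where the induction for signs starts.\<close>

definition pol :: "nat \<Rightarrow> (real \<Rightarrow> real) set" where
  "pol n = {r. \<exists>c. (\<forall>i. c i \<in> H) \<and> r = (\<lambda>x. \<Sum>i<n. c i x * y x ^ i)}"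

lemma polI: "(\<And>i. c i \<in> H) \<Longrightarrow> (\<lambda>x. \<Sum>i<n. c i x * y x ^ i) \<in> pol n"
  unfolding pol_def by blast

lemma polE:
  assumes "r \<in> pol n"
  obtains c where "\<And>i. c i \<in> H" "r = (\<lambda>x. \<Sum>i<n. c i x * y x ^ i)"
  using assms unfolding pol_def by blast

lemma pol_add:
  assumes "r \<in> pol n" "t \<in> pol n"
  shows "(\<lambda>x. r x + t x) \<in> pol n"
proof -
  obtain c where c: "\<And>i. c i \<in> H" "r = (\<lambda>x. \<Sum>i<n. c i x * y x ^ i)"
    using assms(1) unfolding pol_def by blast
  obtain d where d: "\<And>i. d i \<in> H" "t = (\<lambda>x. \<Sum>i<n. d i x * y x ^ i)"
    using assms(2) unfolding pol_def by blast
  have "(\<lambda>x. \<Sum>i<n. (\<lambda>x. c i x + d i x) x * y x ^ i) \<in> pol n"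
    using c d by (intro polI add)
  then show ?thesis by (simp add: c d distrib_right sum.distrib)
qed

lemma pol_smult:
  assumes "r \<in> pol n" "f \<in> H"
  shows "(\<lambda>x. f x * r x) \<in> pol n"
proof -
  obtain c where c: "\<And>i. c i \<in> H" "r = (\<lambda>x. \<Sum>i<n. c i x * y x ^ i)"
    using assms(1) unfolding pol_def by blast
  have "(\<lambda>x. \<Sum>i<n. (\<lambda>x. f x * c i x) x * y x ^ i) \<in> pol n"
    using c assms(2) by (intro polI mult)
  then show ?thesis by (simp add: c sum_distrib_left mult.assoc)
qed

lemma pol_zero: "(\<lambda>_. 0) \<in> pol n"
  using polI[of "\<lambda>_ _. 0" n] zero by simp

lemma pol_monom:
  assumes "i < n" "f \<in> H"
  shows "(\<lambda>x. f x * y x ^ i) \<in> pol n"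
proof -
  have "(\<lambda>x. \<Sum>j<n. (if j = i then f else (\<lambda>_. 0)) x * y x ^ j) \<in> pol n"
    using assms zero by (intro polI) auto
  also have "(\<lambda>x. \<Sum>j<n. (if j = i then f else (\<lambda>_. 0)) x * y x ^ j) = (\<lambda>x. f x * y x ^ i)"
  proof
    fix x
    have "(\<Sum>j<n. (if j = i then f else (\<lambda>_. 0)) x * y x ^ j) = (\<Sum>j<n. if j = i then f x * y x ^ i else 0)"
      by (intro sum.cong) auto
    then show "(\<Sum>j<n. (if j = i then f else (\<lambda>_. 0)) x * y x ^ j) = f x * y x ^ i"
      using assms by simp
  qed
  finally show ?thesis .
qed

lemma pol_sum:
  assumes "finite I" "\<And>i. i \<in> I \<Longrightarrow> r i \<in> pol n"
  shows "(\<lambda>x. \<Sum>i\<in>I. r i x) \<in> pol n"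
  using assms by (induction I rule: finite_induct) (auto intro: pol_zero pol_add)

lemma pol_mono: "r \<in> pol n \<Longrightarrow> n \<le> m \<Longrightarrow> r \<in> pol m"
  by (erule polE) (simp, intro pol_sum pol_monom, auto)

lemma pol_mult:
  assumes "r \<in> pol n" "t \<in> pol m"
  shows "(\<lambda>x. r x * t x) \<in> pol (n + m)"
proof -
  obtain c where c: "\<And>i. c i \<in> H" "r = (\<lambda>x. \<Sum>i<n. c i x * y x ^ i)"
    using assms(1) unfolding pol_def by blast
  obtain d where d: "\<And>i. d i \<in> H" "t = (\<lambda>x. \<Sum>i<m. d i x * y x ^ i)"
    using assms(2) unfolding pol_def by blast
  have "(\<lambda>x. \<Sum>i<n. \<Sum>j<m. (c i x * d j x) * y x ^ (i + j)) \<in> pol (n + m)"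
    using c d by (auto intro!: pol_sum pol_monom mult)
  then show ?thesis
    by (simp add: c d sum_product power_add mult_ac)
qed

lemma y_power_deriv:
  "\<forall>\<^sub>F x in at_top. ((\<lambda>x. y x ^ i) has_real_derivative
     real i * a x * y x ^ i + real i * b x * y x ^ (i - 1)) (at x)"
  using y_deriv
proof eventually_elim
  case (elim x)
  have "((\<lambda>x. y x ^ i) has_real_derivative of_nat i * ((a x * y x + b x) * y x ^ (i - Suc 0))) (at x)"
    by (rule DERIV_power[OF elim])
  moreover have "of_nat i * ((a x * y x + b x) * y x ^ (i - Suc 0))
      = real i * a x * y x ^ i + real i * b x * y x ^ (i - 1)"
    by (cases i) (simp_all add: algebra_simps)
  ultimately show ?case by simp
qed

text \<open>The inhomogeneous term loses one power of y, and for i = 0 its coefficient vanishes.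
  This drop in degree lets the induction in \<open>pol_signed\<close> descend.\<close>

lemma pol_y_power_deriv: "(\<lambda>x. real i * b x * y x ^ (i - 1)) \<in> pol i"
proof (cases i)
  case 0
  then show ?thesis using pol_zero by simp
next
  case (Suc j)
  have "(\<lambda>x. (real i * b x) * y x ^ (i - 1)) \<in> pol i"
    using Suc by (intro pol_monom mult const_of_nat b) auto
  then show ?thesis by simp
qed

lemma pol_deriv:
  assumes "r \<in> pol n"
  shows "\<exists>r'\<in>pol n. \<forall>\<^sub>F x in at_top. (r has_real_derivative r' x) (at x)"
proof -
  obtain c where c: "\<And>i. c i \<in> H" "r = (\<lambda>x. \<Sum>i<n. c i x * y x ^ i)"
    using assms unfolding pol_def by blast
  define t where "t i x = deriv (c i) x * y x ^ i
    + (c i x * (real i * a x * y x ^ i) + c i x * (real i * b x * y x ^ (i - 1)))" for i x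
  have t: "t i \<in> pol n" if "i < n" for i
  proof -
    have "(\<lambda>x. c i x * (real i * b x * y x ^ (i - 1))) \<in> pol n"
      using that by (intro pol_smult c pol_mono[OF pol_y_power_deriv]) auto
    moreover have "(\<lambda>x. c i x * ((real i * a x) * y x ^ i)) \<in> pol n"
      using that by (intro pol_smult c pol_monom mult a const_of_nat)
    moreover have "(\<lambda>x. deriv (c i) x * y x ^ i) \<in> pol n"
      using that by (intro pol_monom deriv c)
    ultimately show ?thesis
      unfolding t_def[abs_def] by (intro pol_add)
  qed
  have "\<forall>\<^sub>F x in at_top. ((\<lambda>x. c i x * y x ^ i) has_real_derivative t i x) (at x)" for i
    using has_deriv[OF c(1)[of i]] y_power_deriv[of i]
  proof eventually_elim
    case (elim x)
    show ?case
      by (rule DERIV_cong[OF DERIV_mult[OF elim]]) (simp add: t_def algebra_simps)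
  qed
  then have "\<forall>\<^sub>F x in at_top. \<forall>i\<in>{..<n}. ((\<lambda>x. c i x * y x ^ i) has_real_derivative t i x) (at x)"
    by (intro eventually_ball_finite) auto
  then have "\<forall>\<^sub>F x in at_top. (r has_real_derivative (\<Sum>i<n. t i x)) (at x)"
    unfolding c(2) by eventually_elim (auto intro!: DERIV_sum)
  moreover have "(\<lambda>x. \<Sum>i<n. t i x) \<in> pol n"
    using t by (intro pol_sum) auto
  ultimately show ?thesis by (rule bexI)
qed

text \<open>
  If \<open>m\<close> is monic of degree \<open>n\<close> in \<open>y\<close>, then the derivative of \<open>m / E ^ n\<close> is, up to a positive
  factor, of degree less than \<open>n\<close>; so \<open>m / E ^ n\<close> is eventually monotone by induction.
\<close>

lemma pol_signed: "r \<in> pol n \<Longrightarrow> eventually_signed r"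
proof (induction n arbitrary: r)
  case 0
  then show ?case by (elim polE) (auto simp: eventually_signed_def)
next
  case (Suc n)
  obtain c where c: "\<And>i. c i \<in> H" "r = (\<lambda>x. \<Sum>i<Suc n. c i x * y x ^ i)"
    using Suc.prems unfolding pol_def by blast
  define l where "l = (\<lambda>x. \<Sum>i<n. c i x * y x ^ i)"
  have l: "l \<in> pol n" unfolding l_def by (rule polI) (rule c)
  have r: "r x = l x + c n x * y x ^ n" for x by (simp add: c l_def)
  show ?case
  proof (cases "\<forall>\<^sub>F x in at_top. c n x = 0")
    case True
    then have "\<forall>\<^sub>F x in at_top. r x = l x" by eventually_elim (simp add: r)
    then show ?thesis
      using Suc.IH[OF l] eventually_signed_cong[of r l] by blast
  next
    case False
    \<comment> \<open>Dividing by the leading coefficient makes the polynomial monic.\<close>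
    obtain g where g: "g \<in> H" "\<forall>\<^sub>F x in at_top. c n x * g x = 1"
      using inverse_ex[OF c(1) False] by blast
    define p where "p = (\<lambda>x. g x * l x)"
    have p: "p \<in> pol n" unfolding p_def by (rule pol_smult[OF l g(1)])
    obtain p' where p': "p' \<in> pol n" "\<forall>\<^sub>F x in at_top. (p has_real_derivative p' x) (at x)"
      using pol_deriv[OF p] by blast
    \<comment> \<open>This is E^n times the derivative of (p + y^n) / E^n. The terms n a y^n coming
      from y^n and from E^n cancel, which leaves degree below n.\<close>
    define u where "u = (\<lambda>x. p' x + real n * b x * y x ^ (n - 1) + (- real n * a x) * p x)"
    have "(\<lambda>_. - real n) \<in> H" using uminus[OF const_of_nat] .
    then have "u \<in> pol n" unfolding u_def
      by (intro pol_add pol_smult p p' pol_y_power_deriv mult a)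
    then have u: "eventually_signed u" by (rule Suc.IH)
    define v where "v = (\<lambda>x. (p x + y x ^ n) / E x ^ n)"
    have v': "\<forall>\<^sub>F x in at_top. (v has_real_derivative u x / E x ^ n) (at x)"
      using p'(2) y_power_deriv[of n] E_deriv E_pos
    proof eventually_elim
      case (elim x)
      have En: "((\<lambda>x. E x ^ n) has_real_derivative real n * a x * E x ^ n) (at x)"
        by (rule DERIV_cong[OF DERIV_power[OF elim(3)]]) (cases n; simp add: algebra_simps)
      show ?case unfolding v_def
        by (rule DERIV_cong[OF DERIV_divide[OF DERIV_add[OF elim(1,2)] En]])
          (use elim(4) in \<open>simp_all add: u_def field_simps\<close>)
    qed
    have "eventually_signed (\<lambda>x. u x / E x ^ n)"
      using u[unfolded eventually_signed_def]
    proof (elim disjE)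
      assume "\<forall>\<^sub>F x in at_top. u x = 0"
      then have "\<forall>\<^sub>F x in at_top. u x / E x ^ n = 0" by eventually_elim simp
      then show ?thesis by (simp add: eventually_signed_def)
    next
      assume "\<forall>\<^sub>F x in at_top. u x > 0"
      with E_pos have "\<forall>\<^sub>F x in at_top. u x / E x ^ n > 0" by eventually_elim simp
      then show ?thesis by (simp add: eventually_signed_def)
    next
      assume "\<forall>\<^sub>F x in at_top. u x < 0"
      with E_pos have "\<forall>\<^sub>F x in at_top. u x / E x ^ n < 0" by eventually_elim (simp add: divide_neg_pos)
      then show ?thesis by (simp add: eventually_signed_def)
    qed
    then have v: "eventually_signed v" by (rule eventually_signed_if_deriv[OF v'])
    have rv: "\<forall>\<^sub>F x in at_top. r x = c n x * (E x ^ n * v x)"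
      using g(2) E_pos
    proof eventually_elim
      case (elim x)
      have "E x ^ n * v x = g x * l x + y x ^ n"
        using elim(2) by (simp add: v_def p_def)
      then have "c n x * (E x ^ n * v x) = (c n x * g x) * l x + c n x * y x ^ n"
        by (simp add: algebra_simps)
      then show ?case using elim(1) by (simp add: r)
    qed
    have "\<forall>\<^sub>F x in at_top. c n x \<noteq> 0"
      using g(2) by eventually_elim auto
    with signed[OF c(1)[of n]] have cn: "(\<forall>\<^sub>F x in at_top. c n x > 0) \<or> (\<forall>\<^sub>F x in at_top. c n x < 0)"
      using False unfolding eventually_signed_def by blast
    have r0: "eventually_signed r" if "\<forall>\<^sub>F x in at_top. v x = 0"
    proof -
      from that rv have "\<forall>\<^sub>F x in at_top. r x = 0" by eventually_elim simp
      then show ?thesis by (simp add: eventually_signed_def)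
    qed
    show ?thesis
      using v[unfolded eventually_signed_def] cn
    proof (elim disjE)
      assume "\<forall>\<^sub>F x in at_top. v x > 0" "\<forall>\<^sub>F x in at_top. c n x > 0"
      with rv E_pos have "\<forall>\<^sub>F x in at_top. r x > 0" by eventually_elim simp
      then show ?thesis by (simp add: eventually_signed_def)
    next
      assume "\<forall>\<^sub>F x in at_top. v x > 0" "\<forall>\<^sub>F x in at_top. c n x < 0"
      with rv E_pos have "\<forall>\<^sub>F x in at_top. r x < 0" by eventually_elim (simp add: mult_neg_pos)
      then show ?thesis by (simp add: eventually_signed_def)
    next
      assume "\<forall>\<^sub>F x in at_top. v x < 0" "\<forall>\<^sub>F x in at_top. c n x > 0"
      with rv E_pos have "\<forall>\<^sub>F x in at_top. r x < 0" by eventually_elim (simp add: mult_pos_neg)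
      then show ?thesis by (simp add: eventually_signed_def)
    next
      assume "\<forall>\<^sub>F x in at_top. v x < 0" "\<forall>\<^sub>F x in at_top. c n x < 0"
      with rv E_pos have "\<forall>\<^sub>F x in at_top. r x > 0" by eventually_elim (simp add: mult_neg_neg mult_pos_neg)
      then show ?thesis by (simp add: eventually_signed_def)
    qed (blast intro: r0)+
  qed
qed

text \<open>The field of fractions. Agreement with a quotient is asked for only eventually, so K is
  saturated by construction.\<close>

definition K :: "(real \<Rightarrow> real) set" where
  "K = {f. \<exists>n. \<exists>r\<in>pol n. \<exists>t\<in>pol n. \<forall>\<^sub>F x in at_top. t x \<noteq> 0 \<and> f x = r x / t x}"

lemma KI: "r \<in> pol n \<Longrightarrow> t \<in> pol m \<Longrightarrow> \<forall>\<^sub>F x in at_top. t x \<noteq> 0 \<Longrightarrow>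
    \<forall>\<^sub>F x in at_top. f x = r x / t x \<Longrightarrow> f \<in> K"
  unfolding K_def
  by (rule CollectI, rule exI[of _ "max n m"], rule bexI[of _ r], rule bexI[of _ t])
    (auto intro: eventually_conj pol_mono)

lemma KE:
  assumes "f \<in> K"
  obtains n r t where "r \<in> pol n" "t \<in> pol n" "\<forall>\<^sub>F x in at_top. t x \<noteq> 0"
    "\<forall>\<^sub>F x in at_top. f x = r x / t x"
  using assms unfolding K_def by (auto simp: eventually_conj_iff)

lemma pol_of_H: "f \<in> H \<Longrightarrow> f \<in> pol 1"
  using pol_monom[of 0 1 f] by simp

lemma pol_subset_K: "r \<in> pol n \<Longrightarrow> r \<in> K"
  by (rule KI[OF _ pol_of_H[OF one]]) auto

lemma K_deriv:
  assumes "f \<in> K"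
  shows "\<exists>f'\<in>K. \<forall>\<^sub>F x in at_top. (f has_real_derivative f' x) (at x)"
proof -
  obtain n r t where f: "r \<in> pol n" "t \<in> pol n" "\<forall>\<^sub>F x in at_top. t x \<noteq> 0"
    "\<forall>\<^sub>F x in at_top. f x = r x / t x" using assms by (rule KE)
  obtain r' where r': "r' \<in> pol n" "\<forall>\<^sub>F x in at_top. (r has_real_derivative r' x) (at x)"
    using pol_deriv[OF f(1)] by blast
  obtain t' where t': "t' \<in> pol n" "\<forall>\<^sub>F x in at_top. (t has_real_derivative t' x) (at x)"
    using pol_deriv[OF f(2)] by blast
  define d where "d = (\<lambda>x. (r' x * t x + (- 1) * (r x * t' x)) / (t x * t x))"
  have "(\<lambda>_. - 1) \<in> H" using uminus[OF one] .
  then have "d \<in> K"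
    unfolding d_def
    by (rule KI[OF pol_add[OF pol_mult[OF r'(1) f(2)] pol_smult[OF pol_mult[OF f(1) t'(1)]]] pol_mult[OF f(2,2)]])
      (use f(3) in eventually_elim, simp)+
  \<comment> \<open>A derivative at x requires equality near x, not merely at x; eventual equality
    provides this for all large x.\<close>
  moreover have "\<forall>\<^sub>F x in at_top. \<forall>\<^sub>F y in nhds x. f y = r y / t y"
  proof -
    obtain X where X: "\<And>x. x \<ge> X \<Longrightarrow> f x = r x / t x"
      using f(4) unfolding eventually_at_top_linorder by blast
    show ?thesis
      using eventually_gt_at_top[of X]
    proof eventually_elim
      case (elim x)
      then have "\<forall>\<^sub>F y in nhds x. y \<in> {X<..}"
        by (intro eventually_nhds_in_open) auto
      then show ?case by eventually_elim (auto intro: X)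
    qed
  qed
  then have "\<forall>\<^sub>F x in at_top. (f has_real_derivative d x) (at x)"
    using r'(2) t'(2) f(3)
  proof eventually_elim
    case (elim x)
    have "((\<lambda>x. r x / t x) has_real_derivative d x) (at x)"
      by (rule DERIV_cong[OF DERIV_divide[OF elim(2-4)]]) (simp add: d_def)
    then show ?case
      using DERIV_cong_ev[OF refl elim(1) refl] by blast
  qed
  ultimately show ?thesis by blast
qed

lemma K_cong: "f \<in> K \<Longrightarrow> \<forall>\<^sub>F x in at_top. g x = f x \<Longrightarrow> g \<in> K"
proof -
  assume "f \<in> K" and g: "\<forall>\<^sub>F x in at_top. g x = f x"
  then obtain n r t where rt: "r \<in> pol n" "t \<in> pol n" "\<forall>\<^sub>F x in at_top. t x \<noteq> 0"
    "\<forall>\<^sub>F x in at_top. f x = r x / t x" by (elim KE)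
  have "\<forall>\<^sub>F x in at_top. g x = r x / t x"
    using g rt(4) by eventually_elim simp
  then show ?thesis by (rule KI[OF rt(1-3)])
qed

theorem hardy_field_K: "hardy_field K"
  unfolding hardy_field_def
proof (intro conjI ballI impI allI)
  show "g \<in> K" if "f \<in> K" "\<forall>\<^sub>F x in at_top. g x = f x" for f g
    using K_cong that by blast
  show "\<forall>\<^sub>F x in at_top. f differentiable (at x)" if "f \<in> K" for f
    using K_deriv[OF that] by (auto elim!: eventually_mono simp: real_differentiable_def)
  show "(\<lambda>_. 0) \<in> K" "(\<lambda>_. 1) \<in> K"
    using pol_subset_K pol_of_H zero one by blast+
  fix f assume f: "f \<in> K"
  obtain n r t where rt: "r \<in> pol n" "t \<in> pol n" "\<forall>\<^sub>F x in at_top. t x \<noteq> 0"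
    "\<forall>\<^sub>F x in at_top. f x = r x / t x" using f by (rule KE)
  have m1: "(\<lambda>_. - 1) \<in> H" using uminus[OF one] .
  show "(\<lambda>x. - f x) \<in> K"
    by (rule KI[OF pol_smult[OF rt(1) m1] rt(2,3)]) (use rt(4) in eventually_elim, simp)
  show "deriv f \<in> K"
  proof -
    obtain f' where f': "f' \<in> K" "\<forall>\<^sub>F x in at_top. (f has_real_derivative f' x) (at x)"
      using K_deriv[OF f] by blast
    show ?thesis
      by (rule K_cong[OF f'(1)]) (use f'(2) in \<open>auto elim!: eventually_mono intro: DERIV_imp_deriv\<close>)
  qed
  show "\<exists>g\<in>K. \<forall>\<^sub>F x in at_top. f x * g x = 1" if "\<not> (\<forall>\<^sub>F x in at_top. f x = 0)"
  proof -
    have "\<not> (\<forall>\<^sub>F x in at_top. r x = 0)"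
    proof
      assume "\<forall>\<^sub>F x in at_top. r x = 0"
      with rt(4) have "\<forall>\<^sub>F x in at_top. f x = 0" by eventually_elim simp
      with that show False by blast
    qed
    \<comment> \<open>Not being the zero germ says only that zeros are not all that eventually
      remains; the eventual sign of r turns this into the absence of zeros.\<close>
    then have r: "\<forall>\<^sub>F x in at_top. r x \<noteq> 0"
      using pol_signed[OF rt(1)] unfolding eventually_signed_def
      by (elim disjE) (simp_all add: eventually_mono)
    then have "(\<lambda>x. t x / r x) \<in> K" by (intro KI[OF rt(2,1)]) auto
    moreover have "\<forall>\<^sub>F x in at_top. f x * (t x / r x) = 1"
      using r rt(3,4) by eventually_elim simp
    ultimately show ?thesis by (intro bexI[of _ "\<lambda>x. t x / r x"])
  qed
  fix g assume "g \<in> K"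
  then obtain m p q where pq: "p \<in> pol m" "q \<in> pol m" "\<forall>\<^sub>F x in at_top. q x \<noteq> 0"
    "\<forall>\<^sub>F x in at_top. g x = p x / q x" by (rule KE)
  have tq: "\<forall>\<^sub>F x in at_top. t x * q x \<noteq> 0"
    using rt(3) pq(3) by eventually_elim simp
  show "(\<lambda>x. f x * g x) \<in> K"
    by (rule KI[OF pol_mult[OF rt(1) pq(1)] pol_mult[OF rt(2) pq(2)] tq])
      (use rt(4) pq(4) in eventually_elim, simp)
  have rq: "(\<lambda>x. r x * q x) \<in> pol (n + m)"
    by (rule pol_mult[OF rt(1) pq(2)])
  have tp: "(\<lambda>x. t x * p x) \<in> pol (n + m)"
    by (rule pol_mult[OF rt(2) pq(1)])
  have "\<forall>\<^sub>F x in at_top. f x + g x = (r x * q x + t x * p x) / (t x * q x)"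
    using rt(3,4) pq(3,4) by eventually_elim (simp add: field_simps)
  then show "(\<lambda>x. f x + g x) \<in> K"
    by (rule KI[OF pol_add[OF rq tp] pol_mult[OF rt(2) pq(2)] tq])
qed

lemma H_subset_K: "H \<subseteq> K"
  using pol_subset_K pol_of_H by blast

lemma y_in_K: "y \<in> K"
  using pol_subset_K[OF pol_monom[of 1 2 "\<lambda>_. 1"]] one by simp

end

section \<open>Splitting off a rational polynomial\<close>

lemma hardy_adjoin_id:
  assumes "hardy_field H"
  shows "\<exists>K. hardy_field K \<and> H \<subseteq> K \<and> (\<lambda>x. x) \<in> K"
proof -
  interpret hardy H by standard (rule assms)
  interpret hardy_extension H "\<lambda>x. x" "\<lambda>_. 0" "\<lambda>_. 1" "\<lambda>_. 1"
    by unfold_locales (simp_all add: zero one)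
  show ?thesis using hardy_field_K H_subset_K y_in_K by blast
qed

text \<open>The case b = 0, with y as its own integrating factor. It covers rational powers of
  positive elements and exp v for v' in H, so that v itself never has to be adjoined.\<close>

lemma hardy_adjoin_exp_integral:
  assumes "hardy_field H" "a \<in> H"
    and "\<forall>\<^sub>F x in at_top. (y has_real_derivative a x * y x) (at x)"
    and "\<forall>\<^sub>F x in at_top. y x > 0"
  shows "\<exists>K. hardy_field K \<and> H \<subseteq> K \<and> y \<in> K"
proof -
  interpret hardy H by standard (rule assms)
  interpret hardy_extension H y a "\<lambda>_. 0" y
    by unfold_locales (use assms in \<open>simp_all add: zero\<close>)
  show ?thesis using hardy_field_K H_subset_K y_in_K by blast
qed

lemma hardy_adjoin_powr:
  assumes "hardy_field H" "f \<in> H" "\<forall>\<^sub>F x in at_top. f x > 0" "c \<in> \<rat>"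
  shows "\<exists>K. hardy_field K \<and> H \<subseteq> K \<and> (\<lambda>x. f x powr c) \<in> K"
proof (rule hardy_adjoin_exp_integral[OF assms(1)])
  interpret hardy H by standard (rule assms)
  show "(\<lambda>x. c * (deriv f x / f x)) \<in> H"
    by (intro mult const_Rats divide deriv assms)
  show "\<forall>\<^sub>F x in at_top. ((\<lambda>x. f x powr c) has_real_derivative c * (deriv f x / f x) * f x powr c) (at x)"
    using assms(3) has_deriv[OF assms(2)]
  proof eventually_elim
    case (elim x)
    show ?case
      by (rule DERIV_cong[OF DERIV_powr[OF elim(2,1) DERIV_const]]) simp
  qed
  show "\<forall>\<^sub>F x in at_top. f x powr c > 0"
    using assms(3) by eventually_elim simp
qed

text \<open>The integrand is frozen to the left of X to be continuous everywhere. The integral from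
  X is differentiable at interior points, hence the strict inequality.\<close>

lemma antiderivative_ex:
  fixes a :: "real \<Rightarrow> real"
  assumes "\<And>x. x \<ge> X \<Longrightarrow> isCont a x"
  shows "\<exists>v. \<forall>x>X. (v has_real_derivative a x) (at x)"
proof -
  define f where "f x = a (max X x)" for x
  have f: "isCont f x" for x
  proof -
    have "isCont (\<lambda>x. max X x) x" by (intro continuous_intros)
    moreover have "isCont a (max X x)" by (rule assms) simp
    ultimately show ?thesis unfolding f_def[abs_def] by (rule isCont_o2)
  qed
  define v where "v x = integral {X..x} f" for x
  have "(v has_real_derivative a x) (at x)" if "x > X" for x
  proof -
    have "continuous_on {X..x + 1} f"
      using f by (intro continuous_at_imp_continuous_on) auto
    then have "(v has_real_derivative f x) (at x within {X..x + 1})"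
      unfolding v_def[abs_def] using that by (intro integral_has_real_derivative) auto
    moreover have "at x within {X..x + 1} = at x"
      using that by (intro at_within_interior) (simp add: interior_atLeastAtMost_real)
    ultimately show ?thesis using that by (simp add: f_def)
  qed
  then show ?thesis by blast
qed

lemma deriv_eventually_cong:
  assumes "\<forall>\<^sub>F x in at_top. f x = (g x :: real)"
  shows "\<forall>\<^sub>F x in at_top. deriv f x = deriv g x"
proof -
  obtain X where X: "\<And>x::real. x \<ge> X \<Longrightarrow> f x = g x"
    using assms unfolding eventually_at_top_linorder by blast
  show ?thesis
    using eventually_gt_at_top[of X]
  proof eventually_elim
    case (elim x)
    then have "\<forall>\<^sub>F y in nhds x. y \<in> {X<..}"
      by (intro eventually_nhds_in_open) auto
    then have "\<forall>\<^sub>F y in nhds x. f y = g y" by eventually_elim (auto intro: X)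
    then show ?case by (intro deriv_cong_ev) auto
  qed
qed

lemma funpow_deriv_monom: "(deriv ^^ n) (\<lambda>x. c * x ^ n) = (\<lambda>x::real. c * fact n)"
proof (induction n arbitrary: c)
  case (Suc n)
  have "deriv (\<lambda>x::real. c * x ^ Suc n) = (\<lambda>x. (c * real (Suc n)) * x ^ n)"
  proof
    fix x :: real
    have "((\<lambda>x. c * x ^ Suc n) has_real_derivative (c * real (Suc n)) * x ^ n) (at x)"
      by (rule derivative_eq_intros refl | simp)+
    then show "deriv (\<lambda>x. c * x ^ Suc n) x = (c * real (Suc n)) * x ^ n"
      by (rule DERIV_imp_deriv)
  qed
  then show ?case
    by (simp only: funpow_Suc_right o_def Suc.IH) (simp add: mult.assoc)
qed simp

section \<open>Iterated derivatives under polynomial growth\<close>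

context hardy
begin

lemma funpow_deriv_diff:
  assumes "f \<in> H" "g \<in> H"
  shows "\<forall>\<^sub>F x in at_top. (deriv ^^ n) (\<lambda>x. f x - g x) x = (deriv ^^ n) f x - (deriv ^^ n) g x"
proof (induction n)
  case (Suc n)
  have "\<forall>\<^sub>F x in at_top. deriv (\<lambda>x. (deriv ^^ n) f x - (deriv ^^ n) g x) x
      = (deriv ^^ Suc n) f x - (deriv ^^ Suc n) g x"
    using has_deriv[OF funpow_deriv[OF assms(1)], of n] has_deriv[OF funpow_deriv[OF assms(2)], of n]
  proof eventually_elim
    case (elim x)
    show ?case using DERIV_imp_deriv[OF DERIV_diff[OF elim]] by simp
  qed
  with deriv_eventually_cong[OF Suc.IH] show ?case
    by eventually_elim simp
qed simp

text \<open>Repeated integration; each constant of integration is absorbed by halving the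
  coefficient of the power.\<close>

lemma power_growth:
  assumes "f \<in> H" "c > 0" "\<forall>\<^sub>F x in at_top. (deriv ^^ n) f x \<ge> c"
  shows "\<exists>c'>0. \<forall>\<^sub>F x in at_top. f x \<ge> c' * x ^ n"
  using assms
proof (induction n arbitrary: f c)
  case 0
  then show ?case by auto
next
  case (Suc n)
  have "\<forall>\<^sub>F x in at_top. (deriv ^^ n) (deriv f) x \<ge> c"
    using Suc.prems(3) by (simp add: funpow_swap1)
  then obtain c' where c': "c' > 0" "\<forall>\<^sub>F x in at_top. deriv f x \<ge> c' * x ^ n"
    using Suc.IH[OF deriv[OF Suc.prems(1)] Suc.prems(2)] by blast
  define k where "k = c' / real (Suc n)"
  have k: "k > 0" using c' by (simp add: k_def)
  have "((\<lambda>x. k * x ^ Suc n) has_real_derivative c' * x ^ n) (at x)" for x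
    by (rule derivative_eq_intros refl | simp add: k_def)+
  then obtain C where C: "\<forall>\<^sub>F x in at_top. k * x ^ Suc n \<le> f x + C"
    using eventually_le_if_deriv_le[OF always_eventually has_deriv[OF Suc.prems(1)] c'(2)] by blast
  have "filterlim (\<lambda>x::real. x ^ Suc n) at_top at_top"
    by (rule filterlim_pow_at_top) (auto simp: filterlim_ident)
  then have "\<forall>\<^sub>F x::real in at_top. x ^ Suc n \<ge> 2 * C / k"
    unfolding filterlim_at_top by blast
  with C have "\<forall>\<^sub>F x in at_top. f x \<ge> (k / 2) * x ^ Suc n"
  proof eventually_elim
    case (elim x)
    have "C \<le> k / 2 * x ^ Suc n" using elim(2) k by (simp add: field_simps)
    then show ?case using elim(1) by linarith
  qed
  then show ?case using k half_gt_zero by blast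
qed

text \<open>The n-th derivative has a finite or infinite limit, being in H. A nonzero one would
  force h or - h to grow at least like x^n, which is impossible for n \<ge> d + 1.\<close>

lemma funpow_deriv_tendsto_0:
  assumes h: "h \<in> H" and growth: "polynomial_growth h"
  shows "\<exists>n\<ge>1. ((deriv ^^ n) h \<longlongrightarrow> 0) at_top"
proof -
  obtain c d where cd: "c \<ge> 1" "d \<ge> 1" "\<And>x. x \<ge> c \<Longrightarrow> \<bar>h x\<bar> \<le> x powr d"
    using growth unfolding polynomial_growth_def by blast
  define n where "n = nat \<lceil>d\<rceil> + 1"
  have n: "real n \<ge> d + 1" unfolding n_def by linarith
  \<comment> \<open>The condition on absolute values lets f be h or - h, so that one argument
    excludes both signs.\<close>
  have no: False if f: "f \<in> H" "\<forall>x. \<bar>f x\<bar> = \<bar>h x\<bar>" "k > 0" "\<forall>\<^sub>F x in at_top. (deriv ^^ n) f x \<ge> k" for f k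
  proof -
    obtain c' where c': "c' > 0" "\<forall>\<^sub>F x in at_top. f x \<ge> c' * x ^ n"
      using power_growth[OF f(1,3,4)] by blast
    have "\<forall>\<^sub>F x::real in at_top. False"
      using c'(2) eventually_ge_at_top[of c] eventually_gt_at_top[of "1 / c'"]
    proof eventually_elim
      case (elim x)
      have x: "x \<ge> 1" using elim cd by simp
      have "c' * x ^ n \<le> x powr d"
        using elim cd(3)[of x] f(2) by (metis abs_le_D1 order.trans)
      moreover have "x ^ n \<ge> x * x powr d"
        using x n powr_mono[of "1 + d" "real n" x] by (simp add: powr_realpow powr_add)
      moreover have "1 < c' * x" using elim c' by (simp add: field_simps)
      ultimately have "x powr d < x powr d"
        using c' x by (smt (verit) mult.assoc mult_left_mono mult_less_cancel_right1 mult_less_cancel_right2 powr_gt_zero mult_strict_right_mono mult_1)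
      then show False by simp
    qed
    then show False by simp
  qed
  have lower: "\<exists>k>0. \<forall>\<^sub>F x in at_top. F x \<ge> (k::real)"
    if "filterlim F at_top (at_top :: real filter) \<or> (\<exists>l>0. (F \<longlongrightarrow> l) at_top)" for F
    using that
  proof (elim disjE exE conjE)
    assume "filterlim F at_top at_top"
    then have "\<forall>\<^sub>F x in at_top. F x \<ge> 1" unfolding filterlim_at_top by blast
    then show ?thesis using zero_less_one by blast
  next
    fix l :: real assume l: "l > 0" "(F \<longlongrightarrow> l) at_top"
    then have "\<forall>\<^sub>F x in at_top. F x > l / 2" by (intro order_tendstoD(1)) auto
    then have "\<forall>\<^sub>F x in at_top. F x \<ge> l / 2" by eventually_elim simp
    then show ?thesis using l half_gt_zero by blast
  qed
  have neg: "\<forall>\<^sub>F x in at_top. (deriv ^^ n) (\<lambda>x. - h x) x = - (deriv ^^ n) h x"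
  proof -
    have "(deriv ^^ n) (\<lambda>_::real. 0::real) = (\<lambda>_. 0)"
      using funpow_deriv_monom[of n 0] by simp
    then show ?thesis using funpow_deriv_diff[OF zero h, of n] by simp
  qed
  have not_pos: "\<not> (filterlim ((deriv ^^ n) h) at_top at_top \<or> (\<exists>l>0. ((deriv ^^ n) h \<longlongrightarrow> l) at_top))"
    using no[OF h] lower[of "(deriv ^^ n) h"] by blast
  have not_neg: "\<not> (filterlim (\<lambda>x. - (deriv ^^ n) h x) at_top at_top \<or> (\<exists>l>0. ((\<lambda>x. - (deriv ^^ n) h x) \<longlongrightarrow> l) at_top))"
  proof
    assume "filterlim (\<lambda>x. - (deriv ^^ n) h x) at_top at_top \<or> (\<exists>l>0. ((\<lambda>x. - (deriv ^^ n) h x) \<longlongrightarrow> l) at_top)"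
    then obtain k where k: "k > 0" "\<forall>\<^sub>F x in at_top. - (deriv ^^ n) h x \<ge> k"
      using lower by blast
    have "\<forall>\<^sub>F x in at_top. (deriv ^^ n) (\<lambda>x. - h x) x \<ge> k"
      using k(2) neg by eventually_elim simp
    then show False using no[OF uminus[OF h] _ k(1)] by simp
  qed
  obtain l where l: "((deriv ^^ n) h \<longlongrightarrow> l) at_top"
    using limit[OF funpow_deriv[OF h], of n] not_pos not_neg by blast
  moreover have "((\<lambda>x. - (deriv ^^ n) h x) \<longlongrightarrow> - l) at_top"
    using l by (rule tendsto_minus)
  ultimately have "l = 0"
    using not_pos not_neg by (metis neg_0_less_iff_less not_less_iff_gr_or_eq)
  then show ?thesis using l by (intro exI[of _ n]) (simp add: n_def)
qed

end

lemma eventually_cong_filterlim: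
  assumes "\<forall>\<^sub>F x in F. f x = g x" "filterlim f G F"
  shows "filterlim g G F"
  using assms filterlim_cong[OF refl refl, of f g F G] by simp

lemma map_poly_of_rat_add_monom:
  "poly (map_poly of_rat (p + monom c k)) x = poly (map_poly of_rat p) x + real_of_rat c * x ^ k"
proof -
  have "map_poly real_of_rat (p + monom c k) = map_poly of_rat p + monom (of_rat c) k"
    by (intro poly_eqI) (simp add: coeff_map_poly of_rat_add)
  then show ?thesis by (simp add: poly_monom)
qed

text \<open>For Q the denominator of c, the numbers n + Q m and n are congruent modulo Q, hence so
  are their powers, and c turns multiples of Q into integers.\<close>

lemma rat_monom_periodic:
  assumes "c \<in> \<rat>"
  shows "\<exists>Q\<ge>1::nat. \<forall>n m. c * real (n + Q * m) ^ k - c * real n ^ k \<in> \<int>"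
proof -
  obtain a b :: int where b: "b > 0" and c: "c = of_int a / of_int b"
    using assms by (metis Rats_cases')
  define Q where "Q = nat b"
  have Q: "Q \<ge> 1" "real_of_int b = real Q" using b by (auto simp: Q_def)
  have "c * real (n + Q * m) ^ k - c * real n ^ k \<in> \<int>" for n m
  proof -
    have "(int n + int Q * int m) ^ k - int n ^ k = (int n + int Q * int m - int n) *
        (\<Sum>i<k. int n ^ (k - Suc i) * (int n + int Q * int m) ^ i)"
      by (rule power_diff_sumr2)
    then have "int Q * int m dvd (int n + int Q * int m) ^ k - int n ^ k"
      by simp
    then obtain j where j: "(int n + int Q * int m) ^ k - int n ^ k = int Q * j"
      by (metis dvd_def mult.assoc)
    have "real (n + Q * m) ^ k - real n ^ k = real_of_int ((int n + int Q * int m) ^ k - int n ^ k)"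
      by simp
    also have "\<dots> = real Q * of_int j" by (simp add: j)
    finally have "c * (real (n + Q * m) ^ k - real n ^ k) = of_int (a * j)"
      using Q by (simp add: c)
    then show ?thesis by (metis Ints_of_int right_diff_distrib)
  qed
  then show ?thesis using Q by blast
qed

text \<open>The two alternatives left after the splitting: an irrational limit, or unbounded growth
  at a vanishing rate. The growth clause is the hypothesis of the theorem for the polynomial 0; it
  decides the second alternative for d = 1.\<close>

definition (in hardy) reduced :: "(real \<Rightarrow> real) \<Rightarrow> nat \<Rightarrow> bool" where
  "reduced f d \<longleftrightarrow> f \<in> H \<and> d \<ge> 1 \<and> filterlim (\<lambda>x. \<bar>deriv f x\<bar> / ln x) at_top at_top \<and>
      ((\<exists>\<alpha>. \<alpha> \<notin> \<rat> \<and> ((deriv ^^ d) f \<longlongrightarrow> \<alpha>) at_top) \<or>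
       (filterlim ((deriv ^^ d) f) at_top at_top \<or> filterlim (\<lambda>x. - (deriv ^^ d) f x) at_top at_top) \<and>
       ((deriv ^^ Suc d) f \<longlongrightarrow> 0) at_top)"

text \<open>Induction on the order of a derivative that tends to 0. The derivative of the preceding
  order has a finite or infinite limit. If this limit is infinite or irrational, g is already
  reduced. A rational limit is removed by subtracting a rational monomial, which leaves the growth
  hypothesis intact because that hypothesis ranges over all rational polynomials.\<close>

lemma (in hardy) rational_polynomial_decomposition:
  assumes id: "(\<lambda>x. x) \<in> H"
    and "n \<ge> 1" "g \<in> H" "((deriv ^^ n) g \<longlongrightarrow> 0) at_top"
    and "\<And>p :: rat poly.
      filterlim (\<lambda>x. \<bar>deriv g x - poly (map_poly of_rat p) x\<bar> / ln x) at_top at_top"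
  shows "\<exists>w f d. \<exists>Q\<ge>1. (\<forall>x. g x = w x + f x) \<and>
      (\<forall>n m::nat. w (real (n + Q * m)) - w (real n) \<in> \<int>) \<and> reduced f d"
  using assms(2-)
proof (induction n arbitrary: g rule: nat_induct_at_least)
  case base
  \<comment> \<open>The descent cannot reach order 1: g' tending to 0 contradicts the growth
    hypothesis for p = 0.\<close>
  have "((\<lambda>x. \<bar>deriv g x\<bar> / ln x) \<longlongrightarrow> 0) at_top"
    using base(2) by (intro real_tendsto_divide_at_top[OF tendsto_rabs] ln_at_top) simp
  moreover have "filterlim (\<lambda>x. \<bar>deriv g x\<bar> / ln x) at_top at_top"
    using base(3)[of 0] by simp
  ultimately have False
    using not_tendsto_and_filterlim_at_infinity[OF trivial_limit_at_top_linorder]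
      filterlim_at_top_imp_at_infinity by blast
  then show ?case ..
next
  case (Suc n)
  have growth: "filterlim (\<lambda>x. \<bar>deriv g x\<bar> / ln x) at_top at_top"
    using Suc.prems(3)[of 0] by simp
  define P where "P \<longleftrightarrow> filterlim ((deriv ^^ n) g) at_top at_top
    \<or> filterlim (\<lambda>x. - (deriv ^^ n) g x) at_top at_top \<or> (\<exists>\<alpha>. \<alpha> \<notin> \<rat> \<and> ((deriv ^^ n) g \<longlongrightarrow> \<alpha>) at_top)"
  show ?case
  proof (cases P)
    case True
    then have "reduced g n"
      using Suc.prems(1,2) Suc.hyps growth unfolding P_def reduced_def by blast
    then show ?thesis
      by (intro exI[of _ "\<lambda>_. 0"] exI[of _ g] exI[of _ n] exI[of _ 1]) simp
  next
    case False
    then obtain \<alpha> where \<alpha>: "\<alpha> \<in> \<rat>" "((deriv ^^ n) g \<longlongrightarrow> \<alpha>) at_top"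
      using limit[OF funpow_deriv[OF Suc.prems(1)], of n] unfolding P_def by blast
    define c where "c = \<alpha> / fact n"
    have "real (fact n) \<in> \<rat>" by (rule Rats_of_nat)
    then have c: "c \<in> \<rat>"
      unfolding c_def using \<alpha> by (intro Rats_divide) simp_all
    define u where "u = (\<lambda>x::real. c * x ^ n)"
    have u: "u \<in> H" unfolding u_def by (intro mult const_Rats c power id)
    have u_deriv: "(u has_real_derivative real n * c * x ^ (n - 1)) (at x)" for x
      unfolding u_def by (rule derivative_eq_intros refl | simp)+
    define f where "f = (\<lambda>x. g x - u x)"
    have f: "f \<in> H" unfolding f_def by (intro diff Suc.prems u)
    have "((deriv ^^ n) f \<longlongrightarrow> 0) at_top"
    proof (rule eventually_cong_filterlim)
      show "\<forall>\<^sub>F x in at_top. (deriv ^^ n) g x - \<alpha> = (deriv ^^ n) f x"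
        using funpow_deriv_diff[OF Suc.prems(1) u, of n] unfolding f_def u_def funpow_deriv_monom
        by eventually_elim (simp add: c_def)
      show "((\<lambda>x. (deriv ^^ n) g x - \<alpha>) \<longlongrightarrow> 0) at_top"
        using tendsto_diff[OF \<alpha>(2) tendsto_const[of \<alpha>]] by simp
    qed
    moreover have "filterlim (\<lambda>x. \<bar>deriv f x - poly (map_poly of_rat p) x\<bar> / ln x) at_top at_top"
      for p :: "rat poly"
    proof -
      have "real n * c \<in> \<rat>" using c by simp
      then obtain r where r: "real_of_rat r = real n * c" by (metis Rats_cases)
      show ?thesis
      proof (rule eventually_cong_filterlim[OF _ Suc.prems(3)[of "p + monom r (n - 1)"]])
        show "\<forall>\<^sub>F x in at_top. \<bar>deriv g x - poly (map_poly of_rat (p + monom r (n - 1))) x\<bar> / ln x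
            = \<bar>deriv f x - poly (map_poly of_rat p) x\<bar> / ln x"
          using has_deriv[OF Suc.prems(1)]
        proof eventually_elim
          case (elim x)
          have "deriv f x = deriv g x - real n * c * x ^ (n - 1)"
            unfolding f_def by (rule DERIV_imp_deriv[OF DERIV_diff[OF elim u_deriv]])
          then have "deriv g x - (poly (map_poly of_rat p) x + real n * c * x ^ (n - 1))
              = deriv f x - poly (map_poly of_rat p) x" by simp
          then show ?case by (simp only: map_poly_of_rat_add_monom r)
        qed
      qed
    qed
    ultimately obtain w f' d and Q :: nat where Q: "Q \<ge> 1" "\<forall>x. f x = w x + f' x"
      "\<forall>n m::nat. w (real (n + Q * m)) - w (real n) \<in> \<int>" and
      rest: "reduced f' d"
      using Suc.IH[OF f] by blast
    obtain B :: nat where B: "B \<ge> 1" "\<And>k m. c * real (k + B * m) ^ n - c * real k ^ n \<in> \<int>"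
      using rat_monom_periodic[OF c] by blast
    \<comment> \<open>Q and B are periods modulo 1 of the two summands on the integers, so their
      product is a common period.\<close>
    define w' where "w' x = w x + u x" for x
    have "w' (real (k + (Q * B) * m)) - w' (real k) \<in> \<int>" for k m :: nat
    proof -
      have "w (real (k + Q * (B * m))) - w (real k) + (c * real (k + B * (Q * m)) ^ n - c * real k ^ n) \<in> \<int>"
        using Q(3) B(2) by (intro Ints_add) blast+
      then show ?thesis by (simp add: w'_def u_def algebra_simps)
    qed
    moreover have "g x = w' x + f' x" for x
      using Q(2)[rule_format, of x] by (simp add: f_def w'_def)
    moreover have "Q * B \<ge> 1" using Q(1) B(1) by simp
    ultimately show ?thesis
      using rest by (intro exI[of _ w'] exI[of _ f'] exI[of _ d] exI[of _ "Q * B"] conjI allI)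
  qed
qed

section \<open>Slowly growing elements and the weight\<close>

lemma powr_at_top:
  assumes "c > 0"
  shows "filterlim (\<lambda>x::real. x powr c) at_top at_top"
  unfolding filterlim_at_top
proof
  fix Z :: real
  show "\<forall>\<^sub>F x in at_top. Z \<le> x powr c"
    using eventually_ge_at_top[of "\<bar>Z\<bar> powr (1 / c)"]
  proof eventually_elim
    case (elim x)
    have "(\<bar>Z\<bar> powr (1 / c)) powr c \<le> x powr c"
      using elim assms by (intro powr_mono2) auto
    then show ?case using assms by (simp add: powr_powr)
  qed
qed

lemma irrational_ex: "\<exists>\<theta>::real. \<theta> > 0 \<and> \<theta> \<notin> \<rat>"
proof (rule ccontr)
  assume "\<not> ?thesis"
  then have "{0<..<1::real} \<subseteq> \<rat>" by auto
  then show False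
    using countable_subset[OF _ countable_rat] uncountable_open_interval[of "0::real" 1] by auto
qed

lemma eventually_signed_dichotomy:
  assumes "eventually_signed f"
  shows "(\<forall>\<^sub>F x in at_top. f x > 0) \<or> (\<forall>\<^sub>F x in at_top. f x \<le> 0)"
  using assms unfolding eventually_signed_def by (elim disjE) (simp_all add: eventually_mono)

lemma (in hardy) slow_deriv_facts:
  fixes D :: nat
  assumes id: "(\<lambda>x. x) \<in> H" and l: "l \<in> H"
    and ul: "\<forall>\<^sub>F x in at_top. (u has_real_derivative l x) (at x)"
    and u: "filterlim u at_top at_top" and l0: "(l \<longlongrightarrow> 0) at_top"
    and D: "D \<ge> 2" and D2: "D = 2 \<Longrightarrow> filterlim (\<lambda>x. u x / ln x) at_top at_top"
  shows "\<forall>\<^sub>F x in at_top. l x > 0"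
    and "\<forall>\<^sub>F x in at_top. deriv l x \<le> 0"
    and "\<forall>\<^sub>F x in at_top. 4 * x * deriv l x + 5 * l x \<ge> 0"
    and "filterlim (\<lambda>x. l x * x powr (real D / 2)) at_top at_top"
proof -
  have unbounded: False if "\<forall>\<^sub>F x in at_top. u x \<le> C" for C
  proof -
    have "\<forall>\<^sub>F x in at_top. u x \<ge> C + 1" using u unfolding filterlim_at_top by blast
    with that have "\<forall>\<^sub>F x::real in at_top. False" by eventually_elim simp
    then show False by simp
  qed
  have const: "\<forall>\<^sub>F x::real in at_top. ((\<lambda>_. 0::real) has_real_derivative 0) (at x)" by simp
  have "\<not> (\<forall>\<^sub>F x in at_top. l x \<le> 0)"
    using eventually_le_if_deriv_le[OF ul const] unbounded by auto
  then show pos: "\<forall>\<^sub>F x in at_top. l x > 0"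
    using eventually_signed_dichotomy[OF signed[OF l]] by blast
  note ld = has_deriv[OF l]
  have "\<not> (\<forall>\<^sub>F x in at_top. deriv l x > 0)"
  proof
    assume "\<forall>\<^sub>F x in at_top. deriv l x > 0"
    then have "\<forall>\<^sub>F x in at_top. deriv l x \<ge> 0" by (rule eventually_mono) simp
    then obtain X where X: "\<forall>x\<ge>X. \<forall>y\<ge>x. l x \<le> l y"
      using eventually_nondecreasing[OF ld] by blast
    obtain Y where Y: "\<forall>x\<ge>Y. l x > 0"
      using pos unfolding eventually_at_top_linorder by blast
    have "\<forall>\<^sub>F x in at_top. l x < l (max X Y)"
      using l0 Y by (intro order_tendstoD(2)) auto
    with eventually_ge_at_top[of "max X Y"] have "\<forall>\<^sub>F x::real in at_top. False"
    proof eventually_elim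
      case (elim x)
      have "l (max X Y) \<le> l x" using X elim(1) by simp
      then show ?case using elim(2) by simp
    qed
    then show False by simp
  qed
  then show "\<forall>\<^sub>F x in at_top. deriv l x \<le> 0"
    using eventually_signed_dichotomy[OF signed[OF deriv[OF l]]] by blast
  \<comment> \<open>Up to the factor x^(1/4) / 4 this is the derivative of x^(5/4) l. The fractional
    power need not lie in H, but m does, so the sign is read off from m.\<close>
  define m where "m = (\<lambda>x. real 4 * (x * deriv l x) + real 5 * l x)"
  have m: "m \<in> H" unfolding m_def by (intro add mult const_of_nat id deriv l)
  define F where "F = (\<lambda>x. x powr (5 / 4) * l x)"
  have F: "\<forall>\<^sub>F x in at_top. (F has_real_derivative x powr (1 / 4) / 4 * m x) (at x)"
    using ld eventually_gt_at_top[of 0]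
  proof eventually_elim
    case (elim x)
    have p: "((\<lambda>x. x powr (5 / 4)) has_real_derivative 5 / 4 * x powr (1 / 4)) (at x)"
      by (rule DERIV_cong[OF has_real_derivative_powr[OF elim(2)]]) simp
    have x: "x powr (5 / 4) = x * x powr (1 / 4)"
      using elim(2) powr_add[of x 1 "1 / 4"] by simp
    have "5 / 4 * x powr (1 / 4) * l x + deriv l x * x powr (5 / 4) = x powr (1 / 4) / 4 * m x"
      unfolding x m_def by (simp add: distrib_left)
    then show ?case
      unfolding F_def by (rule DERIV_cong[OF DERIV_mult[OF p elim(1)]])
  qed
  have "\<not> (\<forall>\<^sub>F x in at_top. m x \<le> 0)"
  proof
    assume "\<forall>\<^sub>F x in at_top. m x \<le> 0"
    then have "\<forall>\<^sub>F x in at_top. x powr (1 / 4) / 4 * m x \<le> 0"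
      by eventually_elim (simp add: mult_nonneg_nonpos)
    then obtain C where C: "\<forall>\<^sub>F x in at_top. F x \<le> 0 + C"
      using eventually_le_if_deriv_le[OF F const] by blast
    \<comment> \<open>C may be negative; a nonnegative constant keeps the antiderivative - 4 C'
      x^(-1/4) below 0, so that u is bounded.\<close>
    define C' where "C' = max C 0"
    have g: "\<forall>\<^sub>F x in at_top. ((\<lambda>x. - 4 * C' * x powr (- 1 / 4)) has_real_derivative C' * x powr (- 5 / 4)) (at x)"
      using eventually_gt_at_top[of 0]
    proof eventually_elim
      case (elim x)
      show ?case
        by (rule DERIV_cong[OF DERIV_cmult[OF has_real_derivative_powr[OF elim, of "- 1 / 4"], of "- 4 * C'"]]) simp
    qed
    have "\<forall>\<^sub>F x in at_top. l x \<le> C' * x powr (- 5 / 4)"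
      using C eventually_gt_at_top[of 0]
    proof eventually_elim
      case (elim x)
      have "l x = F x * x powr (- 5 / 4)"
        using elim by (simp add: F_def flip: powr_add)
      also have "\<dots> \<le> C' * x powr (- 5 / 4)"
        using elim by (intro mult_right_mono) (auto simp: C'_def)
      finally show ?case .
    qed
    then obtain K where "\<forall>\<^sub>F x in at_top. u x \<le> - 4 * C' * x powr (- 1 / 4) + K"
      using eventually_le_if_deriv_le[OF ul g] by blast
    then have "\<forall>\<^sub>F x in at_top. u x \<le> K"
    proof (rule eventually_mono)
      fix x assume "u x \<le> - 4 * C' * x powr (- 1 / 4) + K"
      moreover have "0 \<le> 4 * C' * x powr (- 1 / 4)" by (simp add: C'_def)
      ultimately show "u x \<le> K" by simp
    qed
    then show False by (rule unbounded)
  qed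
  then have m_pos: "\<forall>\<^sub>F x in at_top. m x > 0"
    using eventually_signed_dichotomy[OF signed[OF m]] by blast
  then show "\<forall>\<^sub>F x in at_top. 4 * x * deriv l x + 5 * l x \<ge> 0"
    by eventually_elim (simp add: m_def)
  show "filterlim (\<lambda>x. l x * x powr (real D / 2)) at_top at_top"
  proof (cases "D = 2")
    case True
    have xl: "(\<lambda>x. x * l x) \<in> H" by (intro mult id l)
    \<comment> \<open>A bound x l \<le> C would integrate to u \<le> C ln x + K, although u / ln x
      tends to infinity. Since x l lies in H it has a limit, which can then only be
      infinity.\<close>
    have "\<not> (\<forall>\<^sub>F x in at_top. x * l x \<le> C)" for C
    proof
      assume *: "\<forall>\<^sub>F x in at_top. x * l x \<le> C"
      have g: "\<forall>\<^sub>F x in at_top. ((\<lambda>x. C * ln x) has_real_derivative C / x) (at x)"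
        using eventually_gt_at_top[of 0]
      proof eventually_elim
        case (elim x)
        show ?case by (rule DERIV_cong[OF DERIV_cmult[OF DERIV_ln[OF elim]]]) (simp add: field_simps)
      qed
      have "\<forall>\<^sub>F x in at_top. l x \<le> C / x"
        using * eventually_gt_at_top[of 0] by eventually_elim (simp add: field_simps)
      then obtain K where K: "\<forall>\<^sub>F x in at_top. u x \<le> C * ln x + K"
        using eventually_le_if_deriv_le[OF ul g] by blast
      have "\<forall>\<^sub>F x in at_top. u x / ln x \<ge> C + \<bar>K\<bar> + 1"
        using D2[OF True] unfolding filterlim_at_top by blast
      moreover have "\<forall>\<^sub>F x::real in at_top. ln x \<ge> 1"
        using ln_at_top unfolding filterlim_at_top by blast
      ultimately have "\<forall>\<^sub>F x::real in at_top. False"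
        using K
      proof eventually_elim
        case (elim x)
        have "(C + \<bar>K\<bar> + 1) * ln x \<le> C * ln x + K"
          using elim by (simp add: field_simps)
        moreover have "\<bar>K\<bar> * 1 \<le> \<bar>K\<bar> * ln x" using elim(2) by (intro mult_left_mono) auto
        ultimately show ?case using elim(2) by (simp add: algebra_simps)
      qed
      then show False by simp
    qed
    note not_le = this
    have "filterlim (\<lambda>x. x * l x) at_top at_top"
      using limit[OF xl]
    proof (elim disjE exE)
      fix c assume "((\<lambda>x. x * l x) \<longlongrightarrow> c) at_top"
      then have "\<forall>\<^sub>F x in at_top. x * l x < c + 1" by (rule order_tendstoD) simp
      then have "\<forall>\<^sub>F x in at_top. x * l x \<le> c + 1" by eventually_elim simp
      with not_le show ?thesis by blast
    next
      assume "filterlim (\<lambda>x. - (x * l x)) at_top at_top"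
      then have "\<forall>\<^sub>F x in at_top. - (x * l x) \<ge> 0" unfolding filterlim_at_top by blast
      then have "\<forall>\<^sub>F x in at_top. x * l x \<le> 0" by eventually_elim simp
      with not_le show ?thesis by blast
    qed
    then show ?thesis
    proof (rule eventually_cong_filterlim[rotated])
      show "\<forall>\<^sub>F x in at_top. x * l x = l x * x powr (real D / 2)"
        using eventually_gt_at_top[of 0] by eventually_elim (simp add: True)
    qed
  next
    case False
    \<comment> \<open>Here no logarithm enters: x^(5/4) l is eventually nondecreasing and positive,
      and D / 2 \<ge> 3 / 2 leaves a factor x^(1/4) to spare.\<close>
    then have D3: "real D \<ge> 3" using D by simp
    have "\<forall>\<^sub>F x in at_top. x powr (1 / 4) / 4 * m x \<ge> 0"
      using m_pos by eventually_elim simp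
    then obtain X where X: "\<forall>x\<ge>X. \<forall>y\<ge>x. F x \<le> F y"
      using eventually_nondecreasing[OF F] by blast
    obtain Y where Y: "\<forall>x\<ge>Y. l x > 0"
      using pos unfolding eventually_at_top_linorder by blast
    define c where "c = F (max 1 (max X Y))"
    have c: "c > 0" using Y by (simp add: c_def F_def)
    have "filterlim (\<lambda>x::real. c * x powr (1 / 4)) at_top at_top"
      using c by (intro filterlim_tendsto_pos_mult_at_top[OF tendsto_const] powr_at_top) auto
    then show ?thesis
    proof (rule filterlim_at_top_mono)
      show "\<forall>\<^sub>F x in at_top. c * x powr (1 / 4) \<le> l x * x powr (real D / 2)"
        using eventually_ge_at_top[of "max 1 (max X Y)"]
      proof eventually_elim
        case (elim x)
        have x: "x \<ge> 1" "l x > 0" using elim Y by auto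
        have "c \<le> F x" using X elim unfolding c_def by auto
        then have "c * x powr (1 / 4) \<le> F x * x powr (1 / 4)" by (intro mult_right_mono) auto
        also have "\<dots> = l x * x powr (3 / 2)"
          using x by (simp add: F_def mult.commute mult.left_commute flip: powr_add)
        also have "\<dots> \<le> l x * x powr (real D / 2)"
          using x D3 by (intro mult_left_mono powr_mono) auto
        finally show ?case .
      qed
    qed
  qed
qed

text \<open>The gap is at least y t / (1 + t), and 1 + t \<le> 2.\<close>

lemma half_gap_ineq:
  fixes x y t :: real
  assumes "x * (1 + t) \<le> y" "0 < t" "t \<le> 1" "y > 0"
  shows "y * t / 2 \<le> y - x"
proof (cases "x \<ge> y / 2")
  case True
  then have "y / 2 * t \<le> x * t" using assms by (intro mult_right_mono) auto
  then show ?thesis using assms(1) by (simp add: distrib_left)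
next
  case False
  have "y * t \<le> y * 1" using assms by (intro mult_left_mono) auto
  then show ?thesis using False by simp
qed

text \<open>By mean value theorems the ratio of consecutive differences of V is exp (p t) with t
  close to N. As x p x tends to infinity, this exceeds 1 + 2 C / N for every C and all large N, so
  the limit required in \<open>W_star\<close> is infinity.\<close>

lemma W_star_criterion:
  assumes V: "\<And>x. x > X \<Longrightarrow> (V has_real_derivative exp (P x)) (at x)"
    and P: "\<And>x. x > X \<Longrightarrow> (P has_real_derivative p x) (at x)"
    and p: "filterlim (\<lambda>x. x * p x) at_top at_top"
    and nonneg: "\<And>x. V x \<ge> 0" and lim: "filterlim V at_top at_top"
  shows "(\<lambda>N. V (real N)) \<in> W_star"
proof -
  define U where "U N = V (real N)" for N :: nat
  have incr: "V x < V y" if "X < x" "x < y" for x y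
  proof (rule DERIV_pos_imp_increasing[OF that(2)])
    fix z assume "x \<le> z"
    then show "\<exists>l. (V has_real_derivative l) (at z) \<and> l > 0"
      using V[of z] that by (intro exI[of _ "exp (P z)"]) simp
  qed
  \<comment> \<open>N - 2 must lie above X, and N - 1 must be at least 2 for its
    \<open>bdiff\<close> to be a genuine difference.\<close>
  define N0 where "N0 = nat \<lceil>\<bar>X\<bar>\<rceil> + 3"
  have N0: "real N0 > X + 2" "N0 \<ge> 3" unfolding N0_def by linarith+
  have bd: "bdiff U N = U N - U (N - 1)" "bdiff U (N - 1) = U (N - 1) - U (N - 2)"
    "bdiff (bdiff U) N = bdiff U N - bdiff U (N - 1)" if "N \<ge> N0" for N
    using that N0 by (auto simp: bdiff_def numeral_2_eq_2)
  have pos: "bdiff U N > 0" if "N \<ge> N0" for N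
    unfolding bd(1)[OF that] U_def using that N0 by (simp add: incr of_nat_diff)
  have "filterlim (\<lambda>N. real N * bdiff (bdiff U) N / bdiff U N) at_top sequentially"
    unfolding filterlim_at_top_ge[where c=1]
  proof (intro allI impI)
    fix C :: real assume C: "C \<ge> 1"
    have "\<forall>\<^sub>F x in at_top. x * p x \<ge> 2 * C"
      using p unfolding filterlim_at_top by blast
    then obtain Y where Y: "\<And>x. x \<ge> Y \<Longrightarrow> x * p x \<ge> 2 * C"
      unfolding eventually_at_top_linorder by blast
    have "\<forall>\<^sub>F N in sequentially. real N \<ge> max (2 * C) (Y + 2)"
      using filterlim_real_sequentially unfolding filterlim_at_top by blast
    then show "\<forall>\<^sub>F N in sequentially. C \<le> real N * bdiff (bdiff U) N / bdiff U N"
      using eventually_ge_at_top[of N0]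
    proof eventually_elim
      case (elim N)
      define b where "b = real N"
      have b: "b > X + 2" "b \<ge> 2 * C" "b \<ge> Y + 2" "b > 0"
        using elim N0 C unfolding b_def by auto
      \<comment> \<open>Cauchy's mean value theorem for V and its translate yields both exponentials
        at points exactly 1 apart, which two separate applications of the mean value theorem would
        not.\<close>
      have "\<exists>c>b - 1. c < b \<and> (V (b - 1) - V (b - 1 - 1)) * exp (P c) = (V b - V (b - 1)) * exp (P (c - 1))"
      proof (rule GMVT')
        have shifted: "((\<lambda>t. V (t - 1)) has_real_derivative exp (P (z - 1))) (at z)" if "b - 1 \<le> z" for z
          using V[of "z - 1"] DERIV_shift[of V "exp (P (z - 1))" z "-1"] that b by simp
        show "((\<lambda>t. V (t - 1)) has_real_derivative exp (P (z - 1))) (at z)" if "b - 1 < z" "z < b" for z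
          using shifted that by simp
        show "isCont (\<lambda>t. V (t - 1)) z" if "b - 1 \<le> z" "z \<le> b" for z
          using shifted that DERIV_isCont by blast
        show "isCont V z" if "b - 1 \<le> z" "z \<le> b" for z
          using V[of z] that b DERIV_isCont by force
        show "(V has_real_derivative exp (P z)) (at z)" if "b - 1 < z" "z < b" for z
          using V[of z] that b by simp
      qed simp
      then obtain c where c: "c > b - 1" "c < b"
        "(V (b - 1) - V (b - 2)) * exp (P c) = (V b - V (b - 1)) * exp (P (c - 1))"
        by (auto simp: diff_diff_eq)
      obtain t where t: "c - 1 < t" "t < c" "P c - P (c - 1) = (c - (c - 1)) * p t"
        using MVT2[of "c - 1" c P p] P c b by force
      have "2 * C / b \<le> p t"
      proof -
        have "2 * C \<le> t * p t" using Y t c b by simp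
        moreover have "t > 0" "t \<le> b" using t c b C by auto
        moreover have "p t > 0"
        proof (rule ccontr)
          assume "\<not> p t > 0"
          then have "t * p t \<le> 0" using \<open>t > 0\<close> by (intro mult_nonneg_nonpos) auto
          then show False using \<open>2 * C \<le> t * p t\<close> C by simp
        qed
        moreover have "t * p t \<le> b * p t"
          using \<open>t \<le> b\<close> \<open>p t > 0\<close> by (intro mult_right_mono) auto
        ultimately have "2 * C \<le> b * p t" by linarith
        then show ?thesis using b by (simp add: field_simps)
      qed
      \<comment> \<open>The factor 2 pays for the half lost in \<open>half_gap_ineq\<close>; b \<ge>
        2 C ensures \<tau> \<le> 1.\<close>
      define \<tau> where "\<tau> = 2 * C / b"
      have \<tau>: "\<tau> > 0" "\<tau> \<le> 1" using C b by (simp_all add: \<tau>_def)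
      have "1 + \<tau> \<le> exp \<tau>" by (rule exp_ge_add_one_self)
      also have "\<dots> \<le> exp (P c - P (c - 1))"
        using t \<open>2 * C / b \<le> p t\<close> by (simp add: \<tau>_def)
      finally have "(1 + \<tau>) * exp (P (c - 1)) \<le> exp (P c - P (c - 1)) * exp (P (c - 1))"
        by (rule mult_right_mono) simp
      then have exp_le: "(1 + \<tau>) * exp (P (c - 1)) \<le> exp (P c)"
        by (simp flip: exp_add)
      have bdU: "bdiff U N = V b - V (b - 1)" "bdiff U (N - 1) = V (b - 1) - V (b - 2)"
        using bd[OF elim(2)] elim(2) N0 by (simp_all add: U_def b_def of_nat_diff)
      have Upos: "bdiff U N > 0" using pos elim by simp
      have "bdiff U (N - 1) \<ge> 0"
        using incr[of "b - 2" "b - 1"] b unfolding bdU by simp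
      then have "bdiff U (N - 1) * ((1 + \<tau>) * exp (P (c - 1))) \<le> bdiff U (N - 1) * exp (P c)"
        using exp_le by (rule mult_left_mono[rotated])
      also have "\<dots> = bdiff U N * exp (P (c - 1))"
        unfolding bdU by (rule c(3))
      finally have "(bdiff U (N - 1) * (1 + \<tau>)) * exp (P (c - 1)) \<le> bdiff U N * exp (P (c - 1))"
        by (simp only: mult.assoc)
      then have "bdiff U (N - 1) * (1 + \<tau>) \<le> bdiff U N"
        by (rule mult_right_le_imp_le) simp
      then have "bdiff U N * \<tau> / 2 \<le> bdiff U N - bdiff U (N - 1)"
        using Upos \<tau> by (intro half_gap_ineq) auto
      then have "b * (bdiff U N * \<tau> / 2) \<le> b * bdiff (bdiff U) N"
        unfolding bd(3)[OF elim(2)] using b by (intro mult_left_mono) auto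
      also have "b * (bdiff U N * \<tau> / 2) = C * bdiff U N"
        using b by (simp add: \<tau>_def)
      finally have "C * bdiff U N \<le> b * bdiff (bdiff U) N" .
      then show ?case using Upos by (simp add: field_simps b_def)
    qed
  qed
  then have "(\<lambda>N. ereal (real N * bdiff (bdiff U) N / bdiff U N)) \<longlonglongrightarrow> \<infinity>"
    by (simp add: tendsto_PInfty_eq_at_top)
  moreover have "filterlim U at_top sequentially"
    unfolding U_def by (rule filterlim_compose[OF lim filterlim_real_sequentially])
  moreover have "\<forall>\<^sub>F N in sequentially. bdiff U N \<noteq> 0"
    using eventually_ge_at_top[of N0] by eventually_elim (use pos in force)
  moreover have "U M \<le> U N" if "N0 \<le> M" "M \<le> N" for M N
    using incr[of "real M" "real N"] that N0 by (cases "M = N") (auto simp: U_def)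
  moreover have "U N \<ge> 0" for N by (simp add: U_def nonneg)
  moreover have "N0 \<ge> 1" using N0 by simp
  ultimately have "U \<in> W_star"
    unfolding W_star_def
    by (intro CollectI conjI allI impI exI[of _ N0] exI[of _ "\<infinity>"]) auto
  then show ?thesis by (simp add: U_def[abs_def])
qed

lemma sqrt_over_tendsto_0:
  assumes "filterlim (\<lambda>x. v x / sqrt x) at_top at_top"
  shows "(\<lambda>N. sqrt (real N) / v (real N)) \<longlonglongrightarrow> 0"
  using tendsto_inverse_0_at_top[OF filterlim_compose[OF assms filterlim_real_sequentially]]
  by (simp add: inverse_eq_divide)

text \<open>
  Here \<open>l\<close> is the modulus of the \<open>D\<close>-th derivative of the phase. The assumption \<open>l_slow\<close> says that
  \<open>x powr (5 / 4) * l x\<close> is nondecreasing. The exponent must exceed 1, as otherwise the assumption may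
  fail for an \<open>l\<close> with an unbounded integral, and be less than \<open>3 / 2\<close>, to yield \<open>l_growth\<close> for \<open>D \<ge> 3\<close>.
\<close>

locale slow_phase =
  fixes l l' v :: "real \<Rightarrow> real" and X :: real and D :: nat
  assumes X: "X \<ge> 1" and D: "D \<ge> 2"
    and l_pos: "\<And>x. x \<ge> X \<Longrightarrow> l x > 0"
    and l_deriv: "\<And>x. x \<ge> X \<Longrightarrow> (l has_real_derivative l' x) (at x)"
    and l_decreasing: "\<And>x. x \<ge> X \<Longrightarrow> l' x \<le> 0"
    and l_slow: "\<And>x. x \<ge> X \<Longrightarrow> 4 * x * l' x + 5 * l x \<ge> 0"
    and l_tendsto_0: "(l \<longlongrightarrow> 0) at_top"
    and l_growth: "filterlim (\<lambda>x. l x * x powr (real D / 2)) at_top at_top"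
    and v_deriv: "\<And>x. x > X \<Longrightarrow> (v has_real_derivative l x powr (1 / real D)) (at x)"
begin

text \<open>The derivative of v. Up to constants its reciprocal is the step used near x.\<close>

definition a :: "real \<Rightarrow> real" where
  "a x = l x powr (1 / real D)"

lemma l_antimono: "X \<le> x \<Longrightarrow> x \<le> y \<Longrightarrow> l y \<le> l x"
proof -
  assume x: "X \<le> x" and xy: "x \<le> y"
  show "l y \<le> l x"
  proof (rule DERIV_nonpos_imp_nonincreasing[OF xy])
    fix z assume "x \<le> z"
    then show "\<exists>d. (l has_real_derivative d) (at z) \<and> d \<le> 0"
      using l_deriv[of z] l_decreasing[of z] x by (intro exI[of _ "l' z"]) simp
  qed
qed

text \<open>A consequence of x^(5/4) l being nondecreasing, with the exponent rounded up to the
  integer 2, as y / x \<ge> 1 permits. Together with \<open>l_antimono\<close> it makes l nearly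
  constant on relatively short intervals.\<close>

lemma l_ratio:
  assumes x: "X \<le> x" and xy: "x \<le> y"
  shows "l x \<le> (y / x)\<^sup>2 * l y"
proof -
  define F where "F = (\<lambda>x. x powr (5 / 4) * l x)"
  have "F x \<le> F y"
  proof (rule DERIV_nonneg_imp_nondecreasing[OF xy])
    fix z assume "x \<le> z"
    then have z: "z \<ge> X" "z > 0" using x X by auto
    have p: "((\<lambda>x. x powr (5 / 4)) has_real_derivative 5 / 4 * z powr (1 / 4)) (at z)"
      by (rule DERIV_cong[OF has_real_derivative_powr[OF z(2)]]) simp
    have "z powr (5 / 4) = z * z powr (1 / 4)"
      using z(2) powr_add[of z 1 "1 / 4"] by simp
    then have "5 / 4 * z powr (1 / 4) * l z + l' z * z powr (5 / 4)
        = z powr (1 / 4) / 4 * (4 * z * l' z + 5 * l z)"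
      by (simp add: distrib_left)
    also have "\<dots> \<ge> 0" using l_slow[OF z(1)] by simp
    finally have "5 / 4 * z powr (1 / 4) * l z + l' z * z powr (5 / 4) \<ge> 0" .
    moreover have "(F has_real_derivative 5 / 4 * z powr (1 / 4) * l z + l' z * z powr (5 / 4)) (at z)"
      unfolding F_def by (rule DERIV_mult[OF p l_deriv[OF z(1)]])
    ultimately show "\<exists>d. (F has_real_derivative d) (at z) \<and> 0 \<le> d" by blast
  qed
  then have "x powr (5 / 4) * l x \<le> x powr (5 / 4) * ((y / x) powr (5 / 4) * l y)"
    using x xy X by (simp add: F_def powr_divide)
  then have "l x \<le> (y / x) powr (5 / 4) * l y"
    using x X by (subst (asm) mult_le_cancel_left_pos) auto
  also have "\<dots> \<le> (y / x) powr 2 * l y"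
    using x xy X l_pos[of y] by (intro mult_right_mono powr_mono) auto
  finally show ?thesis using x xy X by (simp add: powr_numeral)
qed

lemma a_pos: "X \<le> x \<Longrightarrow> a x > 0"
  using l_pos[of x] by (simp add: a_def)

lemma a_antimono: "X \<le> x \<Longrightarrow> x \<le> y \<Longrightarrow> a y \<le> a x"
  using l_antimono[of x y] l_pos[of y] unfolding a_def by (intro powr_mono2) auto

lemma a_le_4_mult:
  assumes "X \<le> x" "x \<le> y" "y \<le> 2 * x"
  shows "a x \<le> 4 * a y"
proof -
  have "(y / x)\<^sup>2 \<le> 2\<^sup>2"
    using assms X by (intro power_mono) (auto simp: field_simps)
  then have "(y / x)\<^sup>2 * l y \<le> 4 * l y"
    using l_pos[of y] assms by (intro mult_right_mono) auto
  then have "l x \<le> 4 * l y"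
    using l_ratio[OF assms(1,2)] by linarith
  then have "a x \<le> (4 * l y) powr (1 / real D)"
    using l_pos[of x] assms unfolding a_def by (intro powr_mono2) auto
  also have "\<dots> = 4 powr (1 / real D) * a y"
    using l_pos[of y] assms by (simp add: a_def powr_mult)
  also have "\<dots> \<le> 4 powr 1 * a y"
    using a_pos[of y] assms D by (intro mult_right_mono powr_mono) auto
  finally show ?thesis by simp
qed

section \<open>Growth of the weight\<close>

lemma a_sqrt: "filterlim (\<lambda>x. a x * sqrt x) at_top at_top"
proof (rule eventually_cong_filterlim)
  show "filterlim (\<lambda>x. (l x * x powr (real D / 2)) powr (1 / real D)) at_top at_top"
    using D by (intro filterlim_compose[OF powr_at_top l_growth]) simp
  show "\<forall>\<^sub>F x in at_top. (l x * x powr (real D / 2)) powr (1 / real D) = a x * sqrt x"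
    using eventually_ge_at_top[of X]
  proof eventually_elim
    case (elim x)
    then show ?case
      using l_pos[of x] X D by (simp add: a_def powr_mult powr_powr powr_half_sqrt)
  qed
qed

text \<open>Integration of a \<ge> C / sqrt x for arbitrary C; half of 2 C sqrt x absorbs the
  constant of integration.\<close>

lemma v_sqrt: "filterlim (\<lambda>x. v x / sqrt x) at_top at_top"
  unfolding filterlim_at_top_ge[where c=1]
proof (intro allI impI)
  fix C :: real assume C: "C \<ge> 1"
  have f: "\<forall>\<^sub>F x in at_top. ((\<lambda>x. 2 * C * sqrt x) has_real_derivative C / sqrt x) (at x)"
    using eventually_gt_at_top[of 0]
  proof eventually_elim
    case (elim x)
    show ?case by (rule DERIV_cong[OF DERIV_cmult[OF DERIV_real_sqrt[OF elim]]]) (simp add: field_simps)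
  qed
  have g: "\<forall>\<^sub>F x in at_top. (v has_real_derivative a x) (at x)"
    using eventually_gt_at_top[of X] by eventually_elim (simp add: a_def v_deriv)
  have "\<forall>\<^sub>F x in at_top. a x * sqrt x \<ge> C"
    using a_sqrt unfolding filterlim_at_top by blast
  then have "\<forall>\<^sub>F x in at_top. C / sqrt x \<le> a x"
    using eventually_gt_at_top[of 0] by eventually_elim (simp add: field_simps)
  then obtain K where K: "\<forall>\<^sub>F x in at_top. 2 * C * sqrt x \<le> v x + K"
    using eventually_le_if_deriv_le[OF f g] by blast
  have "\<forall>\<^sub>F x::real in at_top. sqrt x \<ge> max 1 (K / C)"
    using sqrt_at_top unfolding filterlim_at_top by blast
  with K show "\<forall>\<^sub>F x in at_top. C \<le> v x / sqrt x"
  proof eventually_elim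
    case (elim x)
    have "K \<le> C * sqrt x" using elim(2) C by (simp add: field_simps)
    then have "C * sqrt x \<le> v x" using elim(1) by simp
    then show ?case using elim(2) by (simp add: field_simps)
  qed
qed

lemma v_at_top: "filterlim v at_top at_top"
proof (rule eventually_cong_filterlim)
  show "filterlim (\<lambda>x. v x / sqrt x * sqrt x) at_top at_top"
    by (rule filterlim_at_top_mult_at_top[OF v_sqrt sqrt_at_top])
  show "\<forall>\<^sub>F x in at_top. v x / sqrt x * sqrt x = v x"
    using eventually_gt_at_top[of 0] by eventually_elim simp
qed

lemma a_mult_id: "filterlim (\<lambda>x. a x * x) at_top at_top"
proof (rule eventually_cong_filterlim)
  show "filterlim (\<lambda>x. a x * sqrt x * sqrt x) at_top at_top"
    by (rule filterlim_at_top_mult_at_top[OF a_sqrt sqrt_at_top])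
  show "\<forall>\<^sub>F x in at_top. a x * sqrt x * sqrt x = a x * x"
    using eventually_ge_at_top[of 0] by eventually_elim simp
qed

lemma exp_v_in_W_star: "(\<lambda>N. exp (v (real N))) \<in> W_star"
proof (rule W_star_criterion[where X=X])
  \<comment> \<open>P is the logarithm of the derivative of exp v.\<close>
  define P where "P x = ln (l x) / real D + v x" for x
  define p where "p x = l' x / l x / real D + a x" for x
  show "((\<lambda>x. exp (v x)) has_real_derivative exp (P x)) (at x)" if "x > X" for x
  proof -
    have "exp (P x) = exp (v x) * l x powr (1 / real D)"
      using l_pos[of x] that by (simp add: P_def powr_def exp_add)
    then show ?thesis
      using DERIV_fun_exp[OF v_deriv[OF that]] by simp
  qed
  show "(P has_real_derivative p x) (at x)" if "x > X" for x
  proof -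
    have "((\<lambda>x. ln (l x)) has_real_derivative 1 / l x * l' x) (at x)"
      using that l_pos[of x] l_deriv[of x] by (intro DERIV_chain2[OF DERIV_ln_divide]) auto
    then have "((\<lambda>x. ln (l x) / real D) has_real_derivative 1 / l x * l' x / real D) (at x)"
      by (rule DERIV_cdivide)
    from DERIV_add[OF this v_deriv[OF that]] show ?thesis
      unfolding P_def[abs_def] p_def a_def by simp
  qed
  have "filterlim (\<lambda>x. - 1 + a x * x) at_top at_top"
    by (intro filterlim_tendsto_add_at_top[OF tendsto_const] a_mult_id)
  then show "filterlim (\<lambda>x. x * p x) at_top at_top"
  proof (rule filterlim_at_top_mono)
    show "\<forall>\<^sub>F x in at_top. - 1 + a x * x \<le> x * p x"
      using eventually_ge_at_top[of X]
    proof eventually_elim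
      case (elim x)
      have lx: "l x > 0" using l_pos elim by simp
      \<comment> \<open>By \<open>l_slow\<close> the quotient is at least - 5 / 4, rounded here to -
        2; division by D \<ge> 2 leaves - 1, which a x * x outweighs.\<close>
      have "- 2 \<le> x * (l' x / l x)"
        using l_slow[OF elim] lx by (simp add: field_simps)
      then have "- 2 / real D \<le> x * (l' x / l x) / real D"
        using D by (intro divide_right_mono) auto
      moreover have "- 1 \<le> - 2 / real D" using D by (simp add: field_simps)
      ultimately have "- 1 \<le> x * (l' x / l x) / real D" by linarith
      then show ?case by (simp add: p_def distrib_left mult.commute)
    qed
  qed
  show "filterlim (\<lambda>x. exp (v x)) at_top at_top"
    by (rule filterlim_compose[OF exp_at_top v_at_top])
qed simp

text \<open>The direction that turns the hypothesis on s into s N being much larger than 1 / a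
  N.\<close>

lemma bdiff_v_le: "\<forall>\<^sub>F N in sequentially. bdiff (\<lambda>M. ln (exp (v (real M)))) N \<le> 4 * a (real N)"
proof -
  have "\<forall>\<^sub>F N in sequentially. real N \<ge> X + 2"
    using filterlim_real_sequentially unfolding filterlim_at_top by blast
  then show ?thesis
  proof eventually_elim
    case (elim N)
    then have N: "real N \<ge> 3" "N \<ge> 2" using X by auto
    have "\<exists>z>real N - 1. z < real N \<and> v (real N) - v (real N - 1) = (real N - (real N - 1)) * a z"
      by (rule MVT2) (use elim v_deriv in \<open>auto simp: a_def\<close>)
    then obtain z where z: "z > real N - 1" "v (real N) - v (real N - 1) = a z" by auto
    have "a z \<le> a (real N - 1)" using z elim by (intro a_antimono) auto
    also have "\<dots> \<le> 4 * a (real N)" using elim N by (intro a_le_4_mult) auto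
    finally show ?case using z N by (simp add: bdiff_def of_nat_diff)
  qed
qed

text \<open>r solves r^D l = \<theta>, and q is Q times its integer part; the two maxima keep q
  positive and monotone from the start. The step is fixed before \<kappa>, so that it serves all
  k.\<close>

lemma step_ex:
  assumes Q: "Q \<ge> (1::nat)" and \<theta>: "\<theta> > 0"
  defines "r \<equiv> \<lambda>x. (\<theta> / l (max X x)) powr (1 / real D)"
  defines "q \<equiv> \<lambda>b::nat. Q * max 1 (nat \<lfloor>r (real b)\<rfloor>)"
  shows "\<And>b. q b \<ge> 1" "\<And>b. Q dvd q b" "\<And>b b'. b \<le> b' \<Longrightarrow> q b \<le> q b'"
    and "(\<lambda>b. real (q b) / real b) \<longlonglongrightarrow> 0"
    and "\<And>s :: nat \<Rightarrow> nat. filterlim (\<lambda>N. real (s N) * bdiff (\<lambda>M. ln (exp (v (real M)))) N) at_top sequentially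
        \<Longrightarrow> filterlim (\<lambda>N. real (s N) / real (q N)) at_top sequentially"
    and "\<And>(L::nat) \<kappa> \<delta>. \<delta> > 0 \<Longrightarrow> \<forall>\<^sub>F b in sequentially.
        \<forall>x. real b - real L * real (q b) \<le> x \<longrightarrow> x \<le> real b + real L * real (q b) \<longrightarrow>
          \<bar>real (q b) ^ D * (\<kappa> * l x) - real Q ^ D * \<kappa> * \<theta>\<bar> \<le> \<delta>"
proof -
  have r_mono: "r x \<le> r y" if "x \<le> y" for x y
  proof -
    have "l (max X y) \<le> l (max X x)" using that by (intro l_antimono) auto
    then show ?thesis
      unfolding r_def using \<theta> l_pos[of "max X y"] l_pos[of "max X x"]
      by (intro powr_mono2 divide_left_mono) auto
  qed
  define c where "c = \<theta> powr (1 / real D)"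
  have c: "c > 0" using \<theta> by (simp add: c_def)
  have r_eq: "r x = c / a x" if "x \<ge> X" for x
    using that \<theta> l_pos[of x] by (simp add: r_def c_def a_def powr_divide max_absorb2)
  show q1: "q b \<ge> 1" for b
    using Q by (auto simp: q_def)
  show "Q dvd q b" for b by (simp add: q_def)
  show "q b \<le> q b'" if "b \<le> b'" for b b'
  proof -
    have "\<lfloor>r (real b)\<rfloor> \<le> \<lfloor>r (real b')\<rfloor>" using that by (intro floor_mono r_mono) simp
    then show ?thesis unfolding q_def by (intro mult_le_mono max.mono nat_mono) auto
  qed
  have ev_X: "\<forall>\<^sub>F b in sequentially. real b \<ge> X"
    using filterlim_real_sequentially unfolding filterlim_at_top by blast
  have r_top: "filterlim r at_top at_top"
  proof (rule eventually_cong_filterlim)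
    have "((\<lambda>x. (l x / \<theta>) powr (1 / real D)) \<longlongrightarrow> 0) at_top"
    proof (rule tendsto_zero_powrI)
      show "((\<lambda>x. l x / \<theta>) \<longlongrightarrow> 0) at_top"
        using tendsto_divide[OF l_tendsto_0 tendsto_const, of \<theta>] \<theta> by simp
      show "((\<lambda>_. 1 / real D) \<longlongrightarrow> 1 / real D) at_top" by (rule tendsto_const)
      show "\<forall>\<^sub>F x in at_top. 0 \<le> l x / \<theta>"
        using eventually_ge_at_top[of X]
      proof eventually_elim
        case (elim x)
        then show ?case using l_pos[of x] \<theta> by simp
      qed
    qed (use D in simp)
    then show "filterlim (\<lambda>x. inverse ((l x / \<theta>) powr (1 / real D))) at_top at_top"
    proof (rule filterlim_inverse_at_top)
      show "\<forall>\<^sub>F x in at_top. 0 < (l x / \<theta>) powr (1 / real D)"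
        using eventually_ge_at_top[of X] by eventually_elim (use l_pos \<theta> in force)
    qed
    show "\<forall>\<^sub>F x in at_top. inverse ((l x / \<theta>) powr (1 / real D)) = r x"
      using eventually_ge_at_top[of X]
    proof eventually_elim
      case (elim x)
      then show ?case using l_pos[of x] \<theta> by (simp add: r_def max_absorb2 powr_divide)
    qed
  qed
  then have rN: "filterlim (\<lambda>b. r (real b)) at_top sequentially"
    by (rule filterlim_compose[OF _ filterlim_real_sequentially])
  then have ev_r: "\<forall>\<^sub>F b in sequentially. r (real b) \<ge> 1"
    unfolding filterlim_at_top by blast
  have q_eq: "real (q b) = real Q * of_int \<lfloor>r (real b)\<rfloor>" if "r (real b) \<ge> 1" for b
  proof -
    have "\<lfloor>r (real b)\<rfloor> \<ge> 1" using that by simp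
    then have "real (max 1 (nat \<lfloor>r (real b)\<rfloor>)) = of_int \<lfloor>r (real b)\<rfloor>"
      by linarith
    then show ?thesis by (simp only: q_def of_nat_mult)
  qed
  have q_le: "\<forall>\<^sub>F b in sequentially. real (q b) \<le> real Q * c / a (real b)"
    using ev_X ev_r
  proof eventually_elim
    case (elim b)
    have "real Q * of_int \<lfloor>r (real b)\<rfloor> \<le> real Q * r (real b)"
      by (intro mult_left_mono) auto
    then show ?case using q_eq[OF elim(2)] r_eq[OF elim(1)] by simp
  qed
  show q_small: "(\<lambda>b. real (q b) / real b) \<longlonglongrightarrow> 0"
  proof (rule Lim_null_comparison)
    have "(\<lambda>b. real Q * c * inverse (a (real b) * real b)) \<longlonglongrightarrow> real Q * c * 0"
      by (intro tendsto_mult tendsto_const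
        tendsto_inverse_0_at_top[OF filterlim_compose[OF a_mult_id filterlim_real_sequentially]])
    then show "(\<lambda>b. real Q * c * inverse (a (real b) * real b)) \<longlonglongrightarrow> 0" by simp
    show "\<forall>\<^sub>F b in sequentially. norm (real (q b) / real b) \<le> real Q * c * inverse (a (real b) * real b)"
      using q_le
    proof eventually_elim
      case (elim b)
      then have "real (q b) / real b \<le> real Q * c / a (real b) / real b"
        by (intro divide_right_mono) auto
      then show ?case by (simp add: field_simps)
    qed
  qed
  show "filterlim (\<lambda>N. real (s N) / real (q N)) at_top sequentially"
    if s: "filterlim (\<lambda>N. real (s N) * bdiff (\<lambda>M. ln (exp (v (real M)))) N) at_top sequentially"
    for s :: "nat \<Rightarrow> nat"
  proof (rule filterlim_at_top_mono)
    show "filterlim (\<lambda>N. 1 / (4 * real Q * c) * (real (s N) * bdiff (\<lambda>M. ln (exp (v (real M)))) N))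
        at_top sequentially"
      using Q c by (intro filterlim_tendsto_pos_mult_at_top[OF tendsto_const _ s]) auto
    show "\<forall>\<^sub>F N in sequentially. 1 / (4 * real Q * c) * (real (s N) * bdiff (\<lambda>M. ln (exp (v (real M)))) N)
        \<le> real (s N) / real (q N)"
      using bdiff_v_le q_le ev_X
    proof eventually_elim
      case (elim N)
      have a: "a (real N) > 0" using a_pos elim by simp
      have qpos: "real (q N) > 0" using q1[of N] by simp
      have "1 / (4 * real Q * c) * (real (s N) * bdiff (\<lambda>M. ln (exp (v (real M)))) N)
          \<le> 1 / (4 * real Q * c) * (real (s N) * (4 * a (real N)))"
        using elim(1) c by (intro mult_left_mono) auto
      also have "\<dots> = real (s N) / (real Q * c / a (real N))"
        using c Q a by (simp add: field_simps)
      also have "\<dots> \<le> real (s N) / real (q N)"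
        using elim(2) qpos a c Q by (intro divide_left_mono) auto
      finally show ?case .
    qed
  qed
  show "\<forall>\<^sub>F b in sequentially.
        \<forall>x. real b - real L * real (q b) \<le> x \<longrightarrow> x \<le> real b + real L * real (q b) \<longrightarrow>
          \<bar>real (q b) ^ D * (\<kappa> * l x) - real Q ^ D * \<kappa> * \<theta>\<bar> \<le> \<delta>"
    if \<delta>: "\<delta> > 0" for L :: nat and \<kappa> \<delta> :: real
  proof -
    define \<beta> where "\<beta> = real Q ^ D * \<kappa> * \<theta>"
    \<comment> \<open>The 1 in the denominator covers \<beta> = 0.\<close>
    define \<delta>' where "\<delta>' = \<delta> / (\<bar>\<beta>\<bar> + 1)"
    have \<delta>': "\<delta>' > 0" using \<delta> by (simp add: \<delta>'_def)
    \<comment> \<open>\<phi> measures the rounding of r, and \<eta> is the half width of the window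
      relative to b. On the window the quantity in question is \<beta> \<phi>^D times l x / l b, and
      the last ratio lies between (1 + \<eta>)^-2 and (1 - \<eta>)^-2; hence the convergence is
      uniform in x.\<close>
    define \<phi> where "\<phi> b = of_int \<lfloor>r (real b)\<rfloor> / r (real b)" for b :: nat
    define \<eta> where "\<eta> b = real L * (real (q b) / real b)" for b
    have \<phi>: "\<phi> \<longlonglongrightarrow> 1"
    proof (rule tendsto_sandwich)
      show "(\<lambda>b. 1 - inverse (r (real b))) \<longlonglongrightarrow> 1"
        using tendsto_diff[OF tendsto_const[of 1] tendsto_inverse_0_at_top[OF rN]] by simp
      show "\<forall>\<^sub>F b in sequentially. 1 - inverse (r (real b)) \<le> \<phi> b"
        using ev_r
      proof eventually_elim
        case (elim b)
        have "1 - inverse (r (real b)) = (r (real b) - 1) / r (real b)"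
          using elim by (simp add: field_simps)
        also have "\<dots> \<le> \<phi> b"
          unfolding \<phi>_def using elim by (intro divide_right_mono) linarith+
        finally show ?case .
      qed
      show "\<forall>\<^sub>F b in sequentially. \<phi> b \<le> 1"
        using ev_r
      proof eventually_elim
        case (elim b)
        then show ?case by (simp add: \<phi>_def)
      qed
    qed (rule tendsto_const)
    have \<eta>: "\<eta> \<longlonglongrightarrow> 0"
      using tendsto_mult[OF tendsto_const[of "real L"] q_small] by (simp add: \<eta>_def[abs_def])
    have "(\<lambda>b. \<phi> b ^ D / (1 + \<eta> b)\<^sup>2) \<longlonglongrightarrow> 1 ^ D / (1 + 0)\<^sup>2"
      by (intro tendsto_intros \<phi> \<eta>) simp
    then have lower: "\<forall>\<^sub>F b in sequentially. \<phi> b ^ D / (1 + \<eta> b)\<^sup>2 > 1 - \<delta>'"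
      using \<delta>' by (intro order_tendstoD(1)[of _ 1]) auto
    have "(\<lambda>b. \<phi> b ^ D / (1 - \<eta> b)\<^sup>2) \<longlonglongrightarrow> 1 ^ D / (1 - 0)\<^sup>2"
      by (intro tendsto_intros \<phi> \<eta>) simp
    then have upper: "\<forall>\<^sub>F b in sequentially. \<phi> b ^ D / (1 - \<eta> b)\<^sup>2 < 1 + \<delta>'"
      using \<delta>' by (intro order_tendstoD(2)[of _ 1]) auto
    have ev_\<eta>: "\<forall>\<^sub>F b in sequentially. \<eta> b < 1 / 2"
      using \<eta> by (rule order_tendstoD) simp
    have ev_2X: "\<forall>\<^sub>F b in sequentially. real b \<ge> 2 * X"
      using filterlim_real_sequentially unfolding filterlim_at_top by blast
    show ?thesis
      using lower upper ev_\<eta> ev_2X ev_r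
    proof eventually_elim
      case (elim b)
      have b: "real b \<ge> X" "real b > 0" using elim(4) X by auto
      have lb: "l (real b) > 0" using l_pos b by simp
      have \<eta>0: "\<eta> b \<ge> 0" by (simp add: \<eta>_def)
      have \<phi>0: "\<phi> b \<ge> 0" using elim(5) by (simp add: \<phi>_def)
      have rD: "r (real b) ^ D = \<theta> / l (real b)"
      proof -
        have "r (real b) ^ D = r (real b) powr real D"
          using elim(5) by (simp add: powr_realpow)
        then show ?thesis
          using D \<theta> lb b by (simp add: r_def powr_powr max_absorb2)
      qed
      show ?case
      proof (intro allI impI)
        fix x assume x: "real b - real L * real (q b) \<le> x" "x \<le> real b + real L * real (q b)"
        have x': "real b * (1 - \<eta> b) \<le> x" "x \<le> real b * (1 + \<eta> b)"
          using x b by (simp_all add: \<eta>_def algebra_simps)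
        have "real b * (1 / 2) \<le> real b * (1 - \<eta> b)"
          using elim(3) b by (intro mult_left_mono) auto
        then have xX: "x \<ge> X" "x > 0" using x' elim(4) b X by linarith+
        have lx: "l x > 0" using l_pos xX by simp
        define \<rho> where "\<rho> = l x / l (real b)"
        have \<rho>: "1 / (1 + \<eta> b)\<^sup>2 \<le> \<rho>" "\<rho> \<le> 1 / (1 - \<eta> b)\<^sup>2"
        proof -
          have one: "1 / (1 + \<eta> b)\<^sup>2 \<le> 1" "1 \<le> 1 / (1 - \<eta> b)\<^sup>2"
            using \<eta>0 elim(3) by (auto simp: divide_simps power_le_one)
          \<comment> \<open>Since l is nonincreasing, the lower bound is trivial to the left of b
            and the upper bound to the right; the other two cases rest on
            \<open>l_ratio\<close>.\<close>
          show "1 / (1 + \<eta> b)\<^sup>2 \<le> \<rho>"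
          proof (cases "x \<le> real b")
            case True
            then have "1 \<le> \<rho>" using l_antimono[OF xX(1) True] lb by (simp add: \<rho>_def)
            then show ?thesis using one by linarith
          next
            case False
            have "l (real b) \<le> (x / real b)\<^sup>2 * l x" using l_ratio[of "real b" x] b False by simp
            also have "\<dots> \<le> (1 + \<eta> b)\<^sup>2 * l x"
              using x' b xX lx by (intro mult_right_mono power_mono) (auto simp: field_simps)
            finally show ?thesis using \<eta>0 lb by (simp add: \<rho>_def field_simps)
          qed
          show "\<rho> \<le> 1 / (1 - \<eta> b)\<^sup>2"
          proof (cases "x \<le> real b")
            case True
            have "l x \<le> (real b / x)\<^sup>2 * l (real b)" using l_ratio[OF xX(1) True] .
            also have "\<dots> \<le> (1 / (1 - \<eta> b))\<^sup>2 * l (real b)"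
              using x' b xX lb elim(3) by (intro mult_right_mono power_mono) (auto simp: field_simps)
            finally show ?thesis using lb by (simp add: \<rho>_def power_divide pos_divide_le_eq)
          next
            case False
            then have "\<rho> \<le> 1" using l_antimono[of "real b" x] b lb by (simp add: \<rho>_def)
            then show ?thesis using one by linarith
          qed
        qed
        have "\<phi> b ^ D * (1 / (1 + \<eta> b)\<^sup>2) \<le> \<phi> b ^ D * \<rho>" "\<phi> b ^ D * \<rho> \<le> \<phi> b ^ D * (1 / (1 - \<eta> b)\<^sup>2)"
          by (intro mult_left_mono \<rho> zero_le_power \<phi>0)+
        then have close: "\<bar>\<phi> b ^ D * \<rho> - 1\<bar> \<le> \<delta>'"
          using elim(1,2) by auto
        have "real (q b) ^ D * (\<kappa> * l x) = \<beta> * (\<phi> b ^ D * \<rho>)"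
        proof -
          have "of_int \<lfloor>r (real b)\<rfloor> = \<phi> b * r (real b)"
            using elim(5) by (simp add: \<phi>_def)
          then have "real (q b) = real Q * (\<phi> b * r (real b))"
            using q_eq[OF elim(5)] by simp
          then have "real (q b) ^ D = real Q ^ D * (\<phi> b ^ D * (\<theta> / l (real b)))"
            by (simp add: power_mult_distrib rD)
          then show ?thesis by (simp add: \<beta>_def \<rho>_def)
        qed
        then have "\<bar>real (q b) ^ D * (\<kappa> * l x) - \<beta>\<bar> = \<bar>\<beta>\<bar> * \<bar>\<phi> b ^ D * \<rho> - 1\<bar>"
          by (simp add: right_diff_distrib flip: abs_mult)
        also have "\<dots> \<le> \<bar>\<beta>\<bar> * \<delta>'" using close by (intro mult_left_mono) auto
        also have "\<dots> \<le> \<delta>"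
          using \<delta> by (simp add: \<delta>'_def field_simps)
        finally show "\<bar>real (q b) ^ D * (\<kappa> * l x) - real Q ^ D * \<kappa> * \<theta>\<bar> \<le> \<delta>"
          by (simp only: \<beta>_def)
      qed
    qed
  qed
qed

end

section \<open>The theorem\<close>

text \<open>The common end of both cases: q is constant in the irrational case and follows l in the
  slow one. Divisibility by Q makes k w constant modulo 1 along progressions of step q b.\<close>

lemma (in hardy) equidistribution:
  fixes w f :: "real \<Rightarrow> real" and q s :: "nat \<Rightarrow> nat" and k :: int
  assumes f: "f \<in> H" and D: "D \<ge> 1" and \<beta>: "\<beta> \<notin> \<rat>"
    and w: "\<And>n m::nat. w (real (n + Q * m)) - w (real n) \<in> \<int>"
    and q: "\<And>b. q b \<ge> 1" "\<And>b. Q dvd q b" "\<And>b b'. b \<le> b' \<Longrightarrow> q b \<le> q b'"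
    and small: "(\<lambda>b. real (q b) / real b) \<longlonglongrightarrow> 0"
    and lim: "\<And>(L::nat) \<delta>. \<delta> > 0 \<Longrightarrow> \<forall>\<^sub>F b in sequentially.
        \<forall>x. real b - real L * real (q b) \<le> x \<longrightarrow> x \<le> real b + real L * real (q b) \<longrightarrow>
          \<bar>real (q b) ^ D * (of_int k * (deriv ^^ D) f x) - \<beta>\<bar> \<le> \<delta>"
    and s: "filterlim (\<lambda>N. real (s N) / real (q N)) at_top sequentially"
  shows "(\<lambda>N. avg (int N - int (s N)) (int N) (\<lambda>n. e (of_int k * (w (real n) + f (real n))))) \<longlonglongrightarrow> 0"
proof -
  define G where "G i x = of_int k * (deriv ^^ i) f x" for i x
  have "\<forall>\<^sub>F x in at_top. \<forall>i\<in>{..<D}. ((deriv ^^ i) f has_real_derivative deriv ((deriv ^^ i) f) x) (at x)"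
    using has_deriv[OF funpow_deriv[OF f]] by (intro eventually_ball_finite) auto
  then obtain X where X: "\<And>x i. x \<ge> X \<Longrightarrow> i < D \<Longrightarrow>
      ((deriv ^^ i) f has_real_derivative deriv ((deriv ^^ i) f) x) (at x)"
    unfolding eventually_at_top_linorder by auto
  have G: "(G i has_real_derivative G (Suc i) x) (at x)" if "i < D" "x \<ge> X" for i x
    unfolding G_def using DERIV_cmult[OF X[OF that(2,1)], of "of_int k"] by simp
  have kw: "of_int k * w (real (n + q b * m)) - of_int k * w (real n) \<in> \<int>" for b n m
  proof -
    obtain c where c: "q b = Q * c" using q(2)[of b] by blast
    have "of_int k * (w (real (n + Q * (c * m))) - w (real n)) \<in> \<int>"
      using w by (intro Ints_mult Ints_of_int)
    then show ?thesis by (simp add: c right_diff_distrib mult.assoc)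
  qed
  have block: "\<exists>L::nat. L \<ge> 1 \<and> (\<forall>\<^sub>F b in sequentially. L * q b \<le> b \<and>
      norm (\<Sum>n\<in>{b - L * q b..<b}. e (of_int k * w (real n) + G 0 (real n))) \<le> \<epsilon> * real (L * q b))"
    if "\<epsilon> > 0" for \<epsilon>
    by (rule block_sum_bound[where X=X and q=q and G=G and \<beta>=\<beta> and D=D])
      (use D \<beta> that G q(1) small kw lim in \<open>simp_all add: G_def\<close>)
  have "(\<lambda>N. avg (int N - int (s N)) (int N) (\<lambda>n. e (of_int k * w (real n) + G 0 (real n)))) \<longlonglongrightarrow> 0"
    by (rule avg_tendsto_0[OF _ q(1) q(3) block s]) simp_all
  then show ?thesis by (simp add: G_def distrib_left)
qed

text \<open>The weight of the irrational case. Its logarithm has increments 1, so the condition on s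
  says just that s tends to infinity.\<close>

lemma (in hardy) exp_weight:
  fixes f :: "real \<Rightarrow> real" and k :: int and s :: "nat \<Rightarrow> nat"
  shows "\<exists>K. hardy_field K \<and> exp \<in> K" and "(\<lambda>N. exp (real N)) \<in> W_star"
    and "(\<lambda>N. sqrt (real N) / ln (exp (real N))) \<longlonglongrightarrow> 0"
    and "filterlim (\<lambda>N. real (s N) * bdiff (\<lambda>M. ln (exp (real M))) N) at_top sequentially \<Longrightarrow>
      filterlim (\<lambda>N. real (s N)) at_top sequentially"
proof -
  show "\<exists>K. hardy_field K \<and> exp \<in> K"
    using hardy_adjoin_exp_integral[OF hardy one, of exp] DERIV_exp by auto
  show "(\<lambda>N. exp (real N)) \<in> W_star"
    by (rule W_star_criterion[where P="\<lambda>x. x" and p="\<lambda>_. 1"])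
      (auto intro: DERIV_exp exp_at_top filterlim_ident)
  have "filterlim (\<lambda>x. x / sqrt x) at_top at_top"
  proof (rule eventually_cong_filterlim[OF _ sqrt_at_top])
    show "\<forall>\<^sub>F x in at_top. sqrt x = x / sqrt x"
      using eventually_gt_at_top[of 0] by eventually_elim (simp add: real_div_sqrt)
  qed
  then show "(\<lambda>N. sqrt (real N) / ln (exp (real N))) \<longlonglongrightarrow> 0"
    using sqrt_over_tendsto_0[of "\<lambda>x. x"] by simp
  assume s: "filterlim (\<lambda>N. real (s N) * bdiff (\<lambda>M. ln (exp (real M))) N) at_top sequentially"
  show "filterlim (\<lambda>N. real (s N)) at_top sequentially"
  proof (rule eventually_cong_filterlim[OF _ s])
    show "\<forall>\<^sub>F N in sequentially. real (s N) * bdiff (\<lambda>M. ln (exp (real M))) N = real (s N)"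
      using eventually_ge_at_top[of 2] by eventually_elim (simp add: bdiff_def of_nat_diff)
  qed
qed

lemma irrational_mult:
  assumes "\<alpha> \<notin> \<rat>" "c \<in> \<rat>" "c \<noteq> (0::real)"
  shows "c * \<alpha> \<notin> \<rat>"
  using assms Rats_divide[of "c * \<alpha>" c] by auto

theorem theorem5p4:
  fixes h :: "real \<Rightarrow> real"
  assumes "polynomial_growth h"
    and "in_hardy_field h"
    and "\<And>p :: rat poly.
      filterlim (\<lambda>x. \<bar>deriv h x - poly (map_poly of_rat p) x\<bar> / ln x) at_top at_top"
  shows "\<exists>V :: real \<Rightarrow> real.
    in_hardy_field V \<and>
    (\<lambda>N. V (real N)) \<in> W_star \<and>
    (\<lambda>N. sqrt (real N) / ln (V (real N))) \<longlonglongrightarrow> 0 \<and>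
    (\<forall>(k::int) (s :: nat \<Rightarrow> nat).
       k \<noteq> 0 \<longrightarrow>
       filterlim (\<lambda>N. real (s N) * bdiff (\<lambda>M. ln (V (real M))) N) at_top sequentially \<longrightarrow>
       (\<lambda>N. avg (int N - int (s N)) (int N)
              (\<lambda>n. exp (2 * of_real pi * \<i> * of_int k * of_real (h (real n))))) \<longlonglongrightarrow> 0)"
proof -
  have exp_e: "exp (2 * of_real pi * \<i> * of_int k * of_real y) = e (of_int k * y)" for k y
    by (simp add: e_def cis_conv_exp mult_ac)
  obtain H0 where H0: "hardy_field H0" "h \<in> H0"
    using assms(2) unfolding in_hardy_field_def by blast
  \<comment> \<open>Rational monomials are to be subtracted within the field, so the identity is
    adjoined first.\<close>
  obtain H where H: "hardy_field H" "h \<in> H" and id: "(\<lambda>x. x) \<in> H"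
    using hardy_adjoin_id[OF H0(1)] H0(2) by blast
  interpret hardy H by standard (rule H)
  obtain n where n: "n \<ge> 1" "((deriv ^^ n) h \<longlongrightarrow> 0) at_top"
    using funpow_deriv_tendsto_0[OF H(2) assms(1)] by blast
  obtain w f d and Q :: nat where Q: "Q \<ge> 1" and h: "\<And>x. h x = w x + f x"
    and w: "\<And>n m::nat. w (real (n + Q * m)) - w (real n) \<in> \<int>" and red: "reduced f d"
    using rational_polynomial_decomposition[OF id n(1) H(2) n(2) assms(3)] by blast
  have f: "f \<in> H" and d: "d \<ge> 1" and f_ln: "filterlim (\<lambda>x. \<bar>deriv f x\<bar> / ln x) at_top at_top"
    using red unfolding reduced_def by simp_all
  \<comment> \<open>The sign \<sigma> merges growth to plus and to minus infinity.\<close>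
  consider (irrational) \<alpha> where "\<alpha> \<notin> \<rat>" "((deriv ^^ d) f \<longlongrightarrow> \<alpha>) at_top"
    | (slow) \<sigma> where "\<sigma> = 1 \<or> \<sigma> = - 1" "filterlim (\<lambda>x. real_of_int \<sigma> * (deriv ^^ d) f x) at_top at_top"
        "((deriv ^^ Suc d) f \<longlongrightarrow> 0) at_top"
  proof -
    assume 1: "\<And>\<alpha>. \<alpha> \<notin> \<rat> \<Longrightarrow> ((deriv ^^ d) f \<longlongrightarrow> \<alpha>) at_top \<Longrightarrow> thesis"
    assume 2: "\<And>\<sigma>. \<sigma> = 1 \<or> \<sigma> = - 1 \<Longrightarrow>
      filterlim (\<lambda>x. real_of_int \<sigma> * (deriv ^^ d) f x) at_top at_top \<Longrightarrow>
      ((deriv ^^ Suc d) f \<longlongrightarrow> 0) at_top \<Longrightarrow> thesis"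
    from red show thesis
      unfolding reduced_def using 1 2[of 1] 2[of "- 1"] by auto
  qed
  then show ?thesis
  proof cases
    case irrational
    have "(\<lambda>N. avg (int N - int (s N)) (int N) (\<lambda>n. e (of_int k * h (real n)))) \<longlonglongrightarrow> 0"
      if k: "k \<noteq> 0"
        and s: "filterlim (\<lambda>N. real (s N) * bdiff (\<lambda>M. ln (exp (real M))) N) at_top sequentially"
      for k :: int and s :: "nat \<Rightarrow> nat"
      unfolding h
    \<comment> \<open>Since f^(d) converges, the constant step Q suffices: Q^d k f^(d) tends to Q^d
      k \<alpha>, which is irrational.\<close>
    proof (rule equidistribution[where q="\<lambda>_. Q", OF f d _ w])
      define \<beta> where "\<beta> = real Q ^ d * of_int k * \<alpha>"
      show "\<beta> \<notin> \<rat>"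
        unfolding \<beta>_def using irrational(1) Q k by (intro irrational_mult) auto
      show "(\<lambda>b. real Q / real b) \<longlonglongrightarrow> 0"
        by (rule lim_const_over_n)
      show "filterlim (\<lambda>N. real (s N) / real Q) at_top sequentially"
        using filterlim_tendsto_pos_mult_at_top[OF tendsto_const[of "1 / real Q"] _ exp_weight(4)[OF s]] Q
        by simp
      fix L :: nat and \<delta> :: real assume \<delta>: "\<delta> > 0"
      have "((\<lambda>x. real Q ^ d * (of_int k * (deriv ^^ d) f x)) \<longlongrightarrow> real Q ^ d * (of_int k * \<alpha>)) at_top"
        by (intro tendsto_mult tendsto_const irrational(2))
      then have "\<forall>\<^sub>F x in at_top. dist (real Q ^ d * (of_int k * (deriv ^^ d) f x)) \<beta> < \<delta>"
        using \<delta> unfolding \<beta>_def mult.assoc by (rule tendstoD)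
      then obtain Y where Y: "\<And>x. x \<ge> Y \<Longrightarrow> dist (real Q ^ d * (of_int k * (deriv ^^ d) f x)) \<beta> < \<delta>"
        unfolding eventually_at_top_linorder by blast
      have "\<forall>\<^sub>F b in sequentially. real b \<ge> Y + real L * real Q"
        using filterlim_real_sequentially unfolding filterlim_at_top by blast
      then show "\<forall>\<^sub>F b in sequentially.
        \<forall>x. real b - real L * real Q \<le> x \<longrightarrow> x \<le> real b + real L * real Q \<longrightarrow>
          \<bar>real Q ^ d * (of_int k * (deriv ^^ d) f x) - \<beta>\<bar> \<le> \<delta>"
      proof eventually_elim
        case (elim b)
        then show ?case using Y by (force simp: dist_real_def less_imp_le)
      qed
    qed (use Q in auto)
    then show ?thesis
      unfolding exp_e using exp_weight(1,2,3) unfolding in_hardy_field_def by blast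
  next
    case slow
    define D where "D = Suc d"
    define u where "u = (\<lambda>x. real_of_int \<sigma> * (deriv ^^ d) f x)"
    define l where "l = (\<lambda>x. real_of_int \<sigma> * (deriv ^^ D) f x)"
    have "real_of_int \<sigma> \<in> \<rat>" by simp
    then have l: "l \<in> H"
      unfolding l_def by (intro mult const_Rats funpow_deriv f)
    have ul: "\<forall>\<^sub>F x in at_top. (u has_real_derivative l x) (at x)"
      using has_deriv[OF funpow_deriv[OF f], of d]
      by eventually_elim (simp add: u_def l_def D_def DERIV_cmult)
    have l0: "(l \<longlongrightarrow> 0) at_top"
      using tendsto_mult[OF tendsto_const slow(3), of "real_of_int \<sigma>"] by (simp add: l_def D_def)
    have D: "D \<ge> 2" using d by (simp add: D_def)
    have u_ln: "filterlim (\<lambda>x. u x / ln x) at_top at_top" if "D = 2"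
    proof (rule eventually_cong_filterlim[OF _ f_ln])
      have "\<forall>\<^sub>F x in at_top. u x \<ge> 0"
        using slow(2) unfolding u_def filterlim_at_top by blast
      then show "\<forall>\<^sub>F x in at_top. \<bar>deriv f x\<bar> / ln x = u x / ln x"
      proof eventually_elim
        case (elim x)
        have "u x = real_of_int \<sigma> * deriv f x" using that by (simp add: u_def D_def)
        then have "\<bar>deriv f x\<bar> = u x" using slow(1) elim by auto
        then show ?case by simp
      qed
    qed
    have facts: "\<forall>\<^sub>F x in at_top. l x > 0" "\<forall>\<^sub>F x in at_top. deriv l x \<le> 0"
      "\<forall>\<^sub>F x in at_top. 4 * x * deriv l x + 5 * l x \<ge> 0"
      "filterlim (\<lambda>x. l x * x powr (real D / 2)) at_top at_top"
      by (rule slow_deriv_facts[OF id l ul slow(2)[folded u_def] l0 D u_ln]; assumption)+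
    have "\<forall>\<^sub>F x in at_top. x \<ge> 1 \<and> l x > 0 \<and> (l has_real_derivative deriv l x) (at x) \<and> deriv l x \<le> 0
        \<and> 4 * x * deriv l x + 5 * l x \<ge> 0"
      using eventually_ge_at_top[of 1] facts(1-3) has_deriv[OF l] by eventually_elim simp
    then obtain X where X: "\<And>x. x \<ge> X \<Longrightarrow> x \<ge> 1 \<and> l x > 0 \<and> (l has_real_derivative deriv l x) (at x)
        \<and> deriv l x \<le> 0 \<and> 4 * x * deriv l x + 5 * l x \<ge> 0"
      unfolding eventually_at_top_linorder by blast
    have "isCont (\<lambda>x. l x powr (1 / real D)) x" if "x \<ge> X" for x
      using X[OF that] DERIV_isCont[of l] by (intro continuous_intros) auto
    then obtain v where v: "\<And>x. x > X \<Longrightarrow> (v has_real_derivative l x powr (1 / real D)) (at x)"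
      using antiderivative_ex[of X "\<lambda>x. l x powr (1 / real D)"] by blast
    interpret slow_phase l "deriv l" v X D
      by unfold_locales (use X D l0 facts(4) v in auto)
    \<comment> \<open>\<theta> is fixed before k. It enters the step but not the weight, which is
      built from l alone.\<close>
    obtain \<theta> :: real where \<theta>: "\<theta> > 0" "\<theta> \<notin> \<rat>"
      using irrational_ex by blast
    define q where "q b = Q * max 1 (nat \<lfloor>(\<theta> / l (max X (real b))) powr (1 / real D)\<rfloor>)" for b
    note step = step_ex[OF Q \<theta>(1), folded q_def]
    obtain K where K: "hardy_field K" "(\<lambda>x. l x powr (1 / real D)) \<in> K"
      using hardy_adjoin_powr[OF hardy l facts(1), of "1 / real D"] by auto
    have "\<exists>M. hardy_field M \<and> K \<subseteq> M \<and> (\<lambda>x. exp (v x)) \<in> M"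
    proof (rule hardy_adjoin_exp_integral[OF K])
      show "\<forall>\<^sub>F x in at_top. ((\<lambda>x. exp (v x)) has_real_derivative l x powr (1 / real D) * exp (v x)) (at x)"
        using eventually_gt_at_top[of X]
      proof eventually_elim
        case (elim x)
        show ?case using DERIV_fun_exp[OF v[OF elim]] by (simp add: mult.commute)
      qed
    qed simp
    then have V_hardy: "in_hardy_field (\<lambda>x. exp (v x))"
      unfolding in_hardy_field_def by blast
    have V_sqrt: "(\<lambda>N. sqrt (real N) / ln (exp (v (real N)))) \<longlonglongrightarrow> 0"
      using sqrt_over_tendsto_0[OF v_sqrt] by simp
    have avg: "(\<lambda>N. avg (int N - int (s N)) (int N) (\<lambda>n. e (of_int k * h (real n)))) \<longlonglongrightarrow> 0"
      if k: "k \<noteq> 0"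
        and s: "filterlim (\<lambda>N. real (s N) * bdiff (\<lambda>M. ln (exp (v (real M)))) N) at_top sequentially"
      for k :: int and s :: "nat \<Rightarrow> nat"
      unfolding h
    proof (rule equidistribution[OF f _ _ w step(1-4) _ step(5)[OF s]])
      show "D \<ge> 1" using D by simp
      show "real Q ^ D * real_of_int (k * \<sigma>) * \<theta> \<notin> \<rat>"
        using \<theta>(2) Q k slow(1) by (intro irrational_mult) auto
      \<comment> \<open>As \<sigma> squared is 1, the sign moves to k \<sigma>, which takes the
        place of \<kappa>.\<close>
      have eq: "of_int k * (deriv ^^ D) f x = real_of_int (k * \<sigma>) * l x" for x
        using slow(1) by (auto simp: l_def)
      show "\<forall>\<^sub>F b in sequentially. \<forall>x.
          real b - real L * real (q b) \<le> x \<longrightarrow> x \<le> real b + real L * real (q b) \<longrightarrow>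
          \<bar>real (q b) ^ D * (of_int k * (deriv ^^ D) f x) - real Q ^ D * real_of_int (k * \<sigma>) * \<theta>\<bar> \<le> \<delta>"
        if "\<delta> > 0" for L :: nat and \<delta>
        unfolding eq by (rule step(6)[OF that])
    qed
    show ?thesis
      unfolding exp_e using V_hardy exp_v_in_W_star V_sqrt avg
      by (intro exI[of _ "\<lambda>x. exp (v x)"] conjI allI impI)
  qed
qed

end
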